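(* Let $a,b \in (0,\infty)^d$ and let $\varphi \in \mathcal{O}_a^b(\mathbb{C}^d)$ with $\varphi \neq 0$, regarded as a window function in $L^2(\mathbb{R}^d)$ via its restriction to $\mathbb{R}^d$. Let $\tau,\nu \in (0,\infty)^d$ satisfy $$\tau_j < \sqrt{\frac{1}{2b_j e}}, \qquad \nu_j < \sqrt{\frac{a_j}{2\pi^2 e}}, \qquad j \in \{1,\dots,d\},$$ and let $\Lambda = A(\sqrt{\mathbb{Z}})^{2d}$ with $A = \mathrm{diag}(\tau_1,\dots,\tau_d,\nu_1,\dots,\nu_d)$. Then for all $f,h \in L^2(\mathbb{R}^d)$ the following are equivalent: (1) $|V_\varphi f(\lambda)| = |V_\varphi h(\lambda)|$ for every $\lambda \in \Lambda$; (2) there exists $c \in \mathbb{C}$ with $|c|=1$ such that $f = c h$.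
   Context: For $a,b \in (0,\infty)^d$, $\mathcal{O}_a^b(\mathbb{C}^d)$ denotes the set of entire functions $F$ on $\mathbb{C}^d$ for which there is a constant $C>0$ with $|F(x+iy)| \le C \prod_{j=1}^d e^{-a_j x_j^2} e^{b_j y_j^2}$ for all $x,y \in \mathbb{R}^d$. $\sqrt{\mathbb{Z}} := \{\pm\sqrt{n} : n \in \mathbb{N}_0\}$, and for a matrix $A \in \mathrm{GL}(2d,\mathbb{R})$, $A(\sqrt{\mathbb{Z}})^{2d} = \{Az : z \in \sqrt{\mathbb{Z}}\times\cdots\times\sqrt{\mathbb{Z}}\}$. The short-time Fourier transform of $f \in L^2(\mathbb{R}^d)$ with window $g \in L^2(\mathbb{R}^d)$ is $V_g f(x,\omega) = \int_{\mathbb{R}^d} f(t)\overline{g(t-x)} e^{-2\pi i \omega\cdot t}\,dt$ for $(x,\omega) \in \mathbb{R}^{2d}$. *)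

theory Defs
  imports "HOL-Analysis.Analysis"
begin

definition cvec :: "real^'n \<Rightarrow> real^'n \<Rightarrow> complex^'n" where
  "cvec x y = (\<chi> j. Complex (x$j) (y$j))"

text \<open>Entire function on C^d: complex Frechet differentiable everywhere
  (real derivative which is complex linear).\<close>
definition entire_cd :: "(complex^'n \<Rightarrow> complex) \<Rightarrow> bool" where
  "entire_cd F \<longleftrightarrow> (\<forall>z. \<exists>D. (F has_derivative D) (at z) \<and>
       (\<forall>c v. D (\<chi> j. c * v$j) = c * D v))"

definition O_ab :: "real^'n \<Rightarrow> real^'n \<Rightarrow> (complex^'n \<Rightarrow> complex) set" where
  "O_ab a b = {F. entire_cd F \<and> (\<exists>C>0. \<forall>x y.
      norm (F (cvec x y)) \<le> C * (\<Prod>j\<in>UNIV. exp (- a$j * (x$j)^2) * exp (b$j * (y$j)^2)))}"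

definition L2 :: "(real^'n \<Rightarrow> complex) set" where
  "L2 = {f. f \<in> borel_measurable lborel \<and> integrable lborel (\<lambda>t. (norm (f t))^2)}"

definition STFT :: "(real^'n \<Rightarrow> complex) \<Rightarrow> (real^'n \<Rightarrow> complex) \<Rightarrow> (real^'n) \<times> (real^'n) \<Rightarrow> complex" where
  "STFT g f = (\<lambda>(x, \<omega>). integral\<^sup>L lborel
      (\<lambda>t. f t * cnj (g (t - x)) * exp (- 2 * complex_of_real pi * \<i> * complex_of_real (\<omega> \<bullet> t))))"

definition sqrtZ :: "real set" where
  "sqrtZ = {r. \<exists>n::nat. r = sqrt (real n) \<or> r = - sqrt (real n)}"

definition diag_lattice :: "real^'n \<Rightarrow> real^'n \<Rightarrow> ((real^'n) \<times> (real^'n)) set" where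
  "diag_lattice \<tau> \<nu> = {(\<chi> j. \<tau>$j * s$j, \<chi> j. \<nu>$j * r$j) | s r.
      (\<forall>j. s$j \<in> sqrtZ) \<and> (\<forall>j. r$j \<in> sqrtZ)}"

end

theory Submission
  imports Defs "HOL-Complex_Analysis.Conformal_Mappings" "HOL-Probability.Levy"
begin

text \<open>
  If all variables but one are kept real, the difference of the spectrograms of \<open>f\<close> and \<open>h\<close> extends to
  an entire function of the remaining variable that is \<open>O(exp (B (Im z)\<^sup>2))\<close> with \<open>B = 2 b\<^sub>j\<close> (time) or
  \<open>B = 2 \<pi>\<^sup>2 / a\<^sub>j\<close> (frequency); the factor \<open>exp (2 \<pi> x\<^sub>j Im z)\<close> of the frequency extension cancels in
  \<open>V z * cnj (V (cnj z))\<close>. An entire function of this growth with zeros \<open>\<plusminus>\<tau> \<surd>n\<close>, where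
  \<open>B \<tau>\<^sup>2 < 1 / e\<close>, vanishes identically, so one coordinate after the other the spectrograms agree
  everywhere.

  For fixed \<open>x\<close>, injectivity of the Fourier transform turns this into equality of autocorrelations: for
  almost every \<open>s\<close>, \<open>F\<^sub>s(t) = f(t) cnj (f(t - s)) - h(t) cnj (h(t - s))\<close> is orthogonal to all translates
  of \<open>P\<^sub>s(y) = cnj (\<phi>(y)) \<phi>(y - s)\<close>. The transform of \<open>P\<^sub>s\<close> is analytic and not identically zero, hence
  \<open>F\<^sub>s = 0\<close> almost everywhere, which determines \<open>f\<close> up to a unimodular factor.
\<close>

section \<open>Entire functions vanishing on a square-root grid\<close>

text \<open>Zeros are split off one at a time. The points of \<open>S\<close> are distinct, so the
  factors already split off do not vanish at the new point. Hence the cofactor does vanish there,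
  and its difference quotient, completed by the derivative, is again entire.\<close>

lemma entire_factor_zeros:
  fixes f :: "complex \<Rightarrow> complex"
  assumes f: "f holomorphic_on UNIV" and S: "finite S" "\<And>s. s \<in> S \<Longrightarrow> f s = 0"
  shows "\<exists>g. g holomorphic_on UNIV \<and> (\<forall>z. f z = (\<Prod>s\<in>S. z - s) * g z)"
  using S
proof (induction S rule: finite_induct)
  case empty
  then show ?case using f by auto
next
  case (insert x F)
  then obtain g where g: "g holomorphic_on UNIV" "\<And>z. f z = (\<Prod>s\<in>F. z - s) * g z"
    by auto
  have "(\<Prod>s\<in>F. x - s) \<noteq> 0"
    using insert by auto
  then have gx: "g x = 0"
    using g(2)[of x] insert by auto
  let ?g = "\<lambda>z. if z = x then deriv g x else (g z - g x) / (z - x)"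
  have "?g holomorphic_on UNIV"
    using g(1) by (intro pole_lemma_open) auto
  moreover have "f z = (\<Prod>s\<in>insert x F. z - s) * ?g z" for z
    using insert gx g(2)[of z] by auto
  ultimately show ?case by blast
qed

text \<open>Successive terms have ratio tending to \<open>q / (2 * exp 1)\<close>, which is below 1
  for \<open>q < 4\<close>, so the terms are even summable. This is the null sequence that will
  bound an entire function with zeros on the square-root grid.\<close>

lemma prod_shift_over_power_tendsto_0:
  fixes W q :: real
  assumes W: "0 \<le> W" and q: "0 \<le> q" "q < 4"
  shows "(\<lambda>n. (\<Prod>k=1..n. W + real k) * (q / 2) ^ n / real n ^ n) \<longlonglongrightarrow> 0"
    (is "?u \<longlonglongrightarrow> 0")
proof -
  \<comment> \<open>Beyond this \<open>N\<close> the part of the ratio due to \<open>W\<close> is at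
    most half of the gap \<open>1 - q / 4\<close>, so the ratio does not exceed the midpoint of
    \<open>q / 4\<close> and 1.\<close>
  obtain N :: nat where N: "real N > max 1 (W * q / (2 * (1 - q / 4)))"
    using reals_Archimedean2 by blast
  have nn: "0 \<le> ?u n" for n
    using W q by (intro divide_nonneg_nonneg mult_nonneg_nonneg prod_nonneg) auto
  have "summable ?u"
  proof (rule summable_ratio_test)
    show "(1 + q / 4) / 2 < 1" using q by simp
    fix n assume n: "N \<le> n"
    have n1: "real n > 1" "W * q / (2 * (1 - q / 4)) < real n"
      using N n by linarith+
    \<comment> \<open>The lower bound 2 stands in for the limit e of \<open>(1 + 1 / n) ^ n\<close>.
      It turns \<open>q / 2\<close> into \<open>q / 4\<close>, which is enough because
      \<open>q < 4\<close>.\<close>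
    have bern: "2 * real n ^ n \<le> real (Suc n) ^ n"
    proof -
      have "1 + real n * (1 / real n) \<le> (1 + 1 / real n) ^ n"
        by (rule Bernoulli_inequality) (rule order_trans[of _ 0], use n1 in simp_all)
      then have "2 \<le> (real (Suc n) / real n) ^ n"
        using n1 by (simp add: field_simps)
      then show ?thesis
        using n1 by (simp add: power_divide field_simps)
    qed
    have "?u (Suc n) = (\<Prod>k=1..n. W + real k) * (q / 2) ^ n * ((W + real (Suc n)) * (q / 2) / real (Suc n)) / real (Suc n) ^ n"
      by (simp add: field_simps del: of_nat_Suc)
    also have "\<dots> \<le> (\<Prod>k=1..n. W + real k) * (q / 2) ^ n * ((W + real (Suc n)) * (q / 2) / real (Suc n)) / (2 * real n ^ n)"
      using W q n1 bern
      by (intro divide_left_mono mult_nonneg_nonneg prod_nonneg divide_nonneg_nonneg mult_pos_pos) auto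
    also have "\<dots> = ?u n * ((W + real (Suc n)) * (q / 4) / real (Suc n))"
      by (simp add: field_simps)
    also have "\<dots> \<le> ?u n * ((1 + q / 4) / 2)"
    proof (rule mult_left_mono[OF _ nn])
      have "W * q < real n * (2 * (1 - q / 4))"
        using n1 q by (simp add: pos_divide_less_eq)
      also have "\<dots> \<le> real (Suc n) * (2 * (1 - q / 4))"
        using q by (intro mult_right_mono) auto
      finally show "(W + real (Suc n)) * (q / 4) / real (Suc n) \<le> (1 + q / 4) / 2"
        by (simp add: pos_divide_le_eq) (simp add: field_simps)
    qed
    finally show "norm (?u (Suc n)) \<le> (1 + q / 4) / 2 * norm (?u n)"
      using nn[of n] nn[of "Suc n"] by (simp only: real_norm_def abs_of_nonneg mult.commute)
  qed
  then show ?thesis by (rule summable_LIMSEQ_zero)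
qed

text \<open>At the threshold the exponent is 3/e, about 1.10, and the value about 3.02. This leaves
  room to round 1/e up to 2/5 and to compare fifth powers, e^6 against 4^5. The factor 3 is the one
  in the squared radius \<open>3 * \<tau>\<^sup>2 * real N\<close> used next.\<close>

lemma exp_three_div_e_less_4: "exp (3 * x) < (4::real)" if "x < 1 / exp 1" for x
proof -
  have "5 / 2 \<le> exp (1::real)"
    using exp_lower_Taylor_quadratic[of 1] by simp
  then have "1 / exp 1 \<le> (2 / 5 :: real)" by (simp add: field_simps)
  then have "exp (3 * x) \<le> exp (6 / 5)" using that by simp
  moreover have "exp (6 / 5) ^ 5 < (4::real) ^ 5"
  proof -
    have "exp (6 / 5) ^ 5 = exp (1::real) ^ 6"
      by (simp flip: exp_of_nat_mult)
    also have "\<dots> \<le> (272 / 100) ^ 6"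
      using e_less_272 by (intro power_mono) auto
    also have "\<dots> < 4 ^ 5" by (simp add: power_divide)
    finally show ?thesis .
  qed
  then have "exp (6 / 5) < (4::real)"
    by (rule power_less_imp_less_base) simp
  ultimately show ?thesis by linarith
qed

text \<open>Dividing \<open>H\<close> by \<open>\<Prod>k\<le>N. z\<^sup>2 - \<tau>\<^sup>2 k\<close> and applying the maximum principle on the
  circle of radius \<open>R\<close> with \<open>R\<^sup>2 = 3 \<tau>\<^sup>2 N\<close> bounds every value of \<open>H\<close> by a null sequence.\<close>

lemma entire_eq_0_of_sqrt_zeros:
  fixes H :: "complex \<Rightarrow> complex" and B C \<tau> :: real
  assumes hol: "H holomorphic_on UNIV"
    and bound: "\<And>z. norm (H z) \<le> C * exp (B * (Im z)\<^sup>2)"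
    and B: "0 \<le> B" and \<tau>: "0 < \<tau>" "B * \<tau>\<^sup>2 < 1 / exp 1"
    and zeros: "\<And>n. H (of_real (\<tau> * sqrt (real n))) = 0" "\<And>n. H (of_real (- \<tau> * sqrt (real n))) = 0"
  shows "H w = 0"
proof -
  \<comment> \<open>\<open>q ^ N\<close> will be the growth factor
    \<open>exp (B * R\<^sup>2)\<close> on the circle of radius \<open>R\<close>. \<open>W\<close>
    measures \<open>w\<close> against the grid, so that
    \<open>w\<^sup>2 - \<tau>\<^sup>2 * k\<close> has modulus at most
    \<open>\<tau>\<^sup>2 * (W + k)\<close>.\<close>
  define q where "q = exp (3 * (B * \<tau>\<^sup>2))"
  define W where "W = (norm w / \<tau>)\<^sup>2"
  have q: "0 \<le> q" "q < 4"
    using exp_three_div_e_less_4[OF \<tau>(2)] by (auto simp: q_def)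
  have W: "0 \<le> W" "(norm w)\<^sup>2 = \<tau>\<^sup>2 * W"
    using \<tau> by (auto simp: W_def field_simps)
  have C: "0 \<le> C"
    using order_trans[OF norm_ge_zero bound[of 0]] by simp
  have main: "norm (H w) \<le> C * ((\<Prod>k=1..N. W + real k) * (q / 2) ^ N / real N ^ N)"
    if N: "N \<ge> 1" "real N \<ge> W" for N
  proof -
    define p where "p k = \<tau> * sqrt (real k)" for k
    define Sp where "Sp = (\<lambda>k. complex_of_real (p k)) ` {1..N}"
    define Sm where "Sm = (\<lambda>k. complex_of_real (- p k)) ` {1..N}"
    have inj: "inj_on (\<lambda>k. complex_of_real (p k)) {1..N}" "inj_on (\<lambda>k. complex_of_real (- p k)) {1..N}"
      using \<tau> by (auto simp: inj_on_def p_def)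
    have pos: "p k > 0" if "k \<ge> 1" for k
      using \<tau> that by (simp add: p_def)
    \<comment> \<open>With indices starting at 1, the positive and the negative zeros together form
      \<open>2 * N\<close> distinct points.\<close>
    have disj: "Sp \<inter> Sm = {}"
    proof -
      have "complex_of_real (p k) \<noteq> complex_of_real (- p l)" if "k \<ge> 1" "l \<ge> 1" for k l
        using pos[OF that(1)] pos[OF that(2)] unfolding of_real_eq_iff by linarith
      then show ?thesis by (auto simp: Sp_def Sm_def simp del: of_real_minus)
    qed
    have prod: "(\<Prod>s\<in>Sp \<union> Sm. z - s) = (\<Prod>k=1..N. z\<^sup>2 - of_real (\<tau>\<^sup>2 * real k))" for z
    proof -
      have "(\<Prod>s\<in>Sp \<union> Sm. z - s) = (\<Prod>s\<in>Sp. z - s) * (\<Prod>s\<in>Sm. z - s)"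
        using disj by (intro prod.union_disjoint) (auto simp: Sp_def Sm_def)
      also have "\<dots> = (\<Prod>k=1..N. z - of_real (p k)) * (\<Prod>k=1..N. z - of_real (- p k))"
        unfolding Sp_def Sm_def by (simp only: prod.reindex[OF inj(1)] prod.reindex[OF inj(2)] o_def)
      also have "\<dots> = (\<Prod>k=1..N. (z - of_real (p k)) * (z - of_real (- p k)))"
        by (rule prod.distrib[symmetric])
      also have "\<dots> = (\<Prod>k=1..N. z\<^sup>2 - of_real (\<tau>\<^sup>2 * real k))"
      proof (intro prod.cong refl)
        fix k
        have "(p k)\<^sup>2 = \<tau>\<^sup>2 * real k" by (simp add: p_def power_mult_distrib)
        then show "(z - of_real (p k)) * (z - of_real (- p k)) = z\<^sup>2 - of_real (\<tau>\<^sup>2 * real k)"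
          by (simp add: algebra_simps power2_eq_square flip: of_real_mult)
      qed
      finally show ?thesis .
    qed
    have "H s = 0" if "s \<in> Sp \<union> Sm" for s
      using that zeros by (auto simp: Sp_def Sm_def p_def)
    then obtain g where g: "g holomorphic_on UNIV" "\<And>z. H z = (\<Prod>k=1..N. z\<^sup>2 - of_real (\<tau>\<^sup>2 * real k)) * g z"
      using entire_factor_zeros[OF hol, of "Sp \<union> Sm"] prod by (auto simp: Sp_def Sm_def)
    \<comment> \<open>On this circle \<open>z\<^sup>2\<close> has modulus
      \<open>3 * \<tau>\<^sup>2 * real N\<close>, while the squared zeros reach only
      \<open>\<tau>\<^sup>2 * real N\<close>. Each of the \<open>N\<close> factors is therefore at
      least \<open>2 * \<tau>\<^sup>2 * real N\<close>, and this 2 becomes the divisor in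
      \<open>q / 2\<close>.\<close>
    define R where "R = \<tau> * sqrt (3 * real N)"
    have R2: "R\<^sup>2 = 3 * \<tau>\<^sup>2 * real N" and R0: "0 < R"
      using \<tau> N by (auto simp: R_def power_mult_distrib)
    let ?M = "C * q ^ N / (2 * \<tau>\<^sup>2 * real N) ^ N"
    have circle: "norm (g z) \<le> ?M" if z: "norm z = R" for z
    proof -
      have "(2 * \<tau>\<^sup>2 * real N) ^ N = (\<Prod>k=1..N. 2 * \<tau>\<^sup>2 * real N)" by simp
      also have "\<dots> \<le> (\<Prod>k=1..N. norm (z\<^sup>2 - of_real (\<tau>\<^sup>2 * real k)))"
      proof (intro prod_mono conjI)
        fix k assume k: "k \<in> {1..N}"
        have "norm (z\<^sup>2) - norm (complex_of_real (\<tau>\<^sup>2 * real k)) \<le> norm (z\<^sup>2 - of_real (\<tau>\<^sup>2 * real k))"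
          by (rule norm_triangle_ineq2)
        moreover have "norm (z\<^sup>2) = 3 * \<tau>\<^sup>2 * real N" using z R2 by (simp add: norm_power)
        moreover have "norm (complex_of_real (\<tau>\<^sup>2 * real k)) \<le> \<tau>\<^sup>2 * real N"
          using k by (simp add: norm_mult norm_power mult_left_mono)
        ultimately show "2 * \<tau>\<^sup>2 * real N \<le> norm (z\<^sup>2 - of_real (\<tau>\<^sup>2 * real k))" by linarith
      qed simp
      finally have Q: "(2 * \<tau>\<^sup>2 * real N) ^ N \<le> norm (\<Prod>k=1..N. z\<^sup>2 - of_real (\<tau>\<^sup>2 * real k))"
        by (simp add: prod_norm)
      have "(Im z)\<^sup>2 \<le> R\<^sup>2"
        by (simp add: cmod_power2 flip: z)
      then have "norm (H z) \<le> C * exp (B * R\<^sup>2)"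
        using B C by (intro order_trans[OF bound] mult_left_mono) (auto intro: mult_left_mono)
      also have "exp (B * R\<^sup>2) = q ^ N"
        by (simp add: R2 q_def algebra_simps flip: exp_of_nat_mult)
      finally have "norm (\<Prod>k=1..N. z\<^sup>2 - of_real (\<tau>\<^sup>2 * real k)) * norm (g z) \<le> C * q ^ N"
        by (simp add: g(2) norm_mult)
      then have "(2 * \<tau>\<^sup>2 * real N) ^ N * norm (g z) \<le> C * q ^ N"
        using mult_right_mono[OF Q norm_ge_zero[of "g z"]] by linarith
      then show ?thesis
        using \<tau> N by (subst pos_le_divide_eq) (auto simp: mult.commute)
    qed
    \<comment> \<open>The condition \<open>real N \<ge> W\<close> places \<open>w\<close> inside the
      disc, so the bound on the circle reaches \<open>g w\<close>.\<close>
    have wR: "norm w \<le> R"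
    proof (rule power2_le_imp_le)
      show "(norm w)\<^sup>2 \<le> R\<^sup>2"
      proof -
        have "\<tau>\<^sup>2 * W \<le> \<tau>\<^sup>2 * real N" using N by (intro mult_left_mono) auto
        moreover have "0 \<le> \<tau>\<^sup>2 * real N" by simp
        ultimately show ?thesis unfolding W(2) R2 by linarith
      qed
    qed (use R0 in simp)
    have gw: "norm (g w) \<le> ?M"
    proof (rule maximum_modulus_frontier[of g "cball 0 R"])
      show "g holomorphic_on interior (cball 0 R)" "continuous_on (closure (cball 0 R)) g"
        using g(1) by (auto intro: holomorphic_on_subset holomorphic_on_imp_continuous_on continuous_on_subset)
    qed (use wR R0 circle in auto)
    have "norm (\<Prod>k=1..N. w\<^sup>2 - of_real (\<tau>\<^sup>2 * real k)) \<le> (\<Prod>k=1..N. \<tau>\<^sup>2 * (W + real k))"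
      unfolding prod_norm[symmetric]
    proof (intro prod_mono conjI norm_ge_zero)
      fix k
      have "norm (w\<^sup>2 - of_real (\<tau>\<^sup>2 * real k)) \<le> norm (w\<^sup>2) + norm (complex_of_real (\<tau>\<^sup>2 * real k))"
        by (rule norm_triangle_ineq4)
      also have "\<dots> = \<tau>\<^sup>2 * (W + real k)"
        using W by (simp add: norm_power norm_mult algebra_simps)
      finally show "norm (w\<^sup>2 - of_real (\<tau>\<^sup>2 * real k)) \<le> \<tau>\<^sup>2 * (W + real k)" .
    qed
    also have "\<dots> = (\<tau>\<^sup>2) ^ N * (\<Prod>k=1..N. W + real k)"
      by (simp add: prod.distrib)
    finally have "norm (H w) \<le> (\<tau>\<^sup>2) ^ N * (\<Prod>k=1..N. W + real k) * ?M"
      unfolding g(2)[of w] norm_mult using W gw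
      by (intro mult_mono) (auto intro!: prod_nonneg mult_nonneg_nonneg)
    also have "\<dots> = C * ((\<Prod>k=1..N. W + real k) * (q / 2) ^ N / real N ^ N)"
      using \<tau> N by (simp add: power_mult_distrib power_divide field_simps)
    finally show ?thesis .
  qed
  have "(\<lambda>N. C * ((\<Prod>k=1..N. W + real k) * (q / 2) ^ N / real N ^ N)) \<longlonglongrightarrow> C * 0"
    by (intro tendsto_mult_left prod_shift_over_power_tendsto_0 W q)
  moreover obtain N0 :: nat where "real N0 \<ge> max 1 W"
    using real_arch_simple by blast
  then have "\<forall>N\<ge>N0. norm (H w) \<le> C * ((\<Prod>k=1..N. W + real k) * (q / 2) ^ N / real N ^ N)"
    by (intro allI impI main) auto
  ultimately have "norm (H w) \<le> C * 0"
    by (intro LIMSEQ_le_const) blast+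
  then show ?thesis by simp
qed

text \<open>The squared modulus on the real axis extends to the entire function
  \<open>V z * cnj (V (cnj z))\<close>. Multiplying the bounds at \<open>z\<close> and
  \<open>cnj z\<close> doubles \<open>B\<close> and cancels the term \<open>\<kappa> * Im z\<close>,
  which is odd. This is why the sampling condition carries \<open>2 * B\<close>.\<close>

lemma modulus_eq_of_sqrt_samples:
  fixes V W :: "complex \<Rightarrow> complex" and B \<kappa> \<tau> r :: real
  assumes hol: "V holomorphic_on UNIV" "W holomorphic_on UNIV"
    and boundV: "\<And>z. norm (V z) \<le> K * exp (B * (Im z)\<^sup>2 + \<kappa> * Im z)"
    and boundW: "\<And>z. norm (W z) \<le> L * exp (B * (Im z)\<^sup>2 + \<kappa> * Im z)"
    and B: "0 \<le> B" and \<tau>: "0 < \<tau>" "2 * B * \<tau>\<^sup>2 < 1 / exp 1"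
    and eq: "\<And>n. norm (V (of_real (\<tau> * sqrt (real n)))) = norm (W (of_real (\<tau> * sqrt (real n))))"
      "\<And>n. norm (V (of_real (- \<tau> * sqrt (real n)))) = norm (W (of_real (- \<tau> * sqrt (real n))))"
  shows "norm (V (of_real r)) = norm (W (of_real r))"
proof -
  define H where "H z = V z * cnj (V (cnj z)) - W z * cnj (W (cnj z))" for z
  have H_real: "H (of_real x) = of_real ((norm (V (of_real x)))\<^sup>2 - (norm (W (of_real x)))\<^sup>2)" for x
    unfolding H_def complex_cnj_complex_of_real of_real_diff complex_norm_square ..
  have "(cnj \<circ> V \<circ> cnj) holomorphic_on UNIV" "(cnj \<circ> W \<circ> cnj) holomorphic_on UNIV"
    by (intro holomorphic_on_compose_cnj_cnj holomorphic_on_subset[OF hol(1)] holomorphic_on_subset[OF hol(2)] subset_UNIV open_UNIV)+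
  then have holH: "H holomorphic_on UNIV"
    unfolding H_def[abs_def] o_def by (intro holomorphic_on_diff holomorphic_on_mult hol)
  have boundH: "norm (H z) \<le> (K\<^sup>2 + L\<^sup>2) * exp (2 * B * (Im z)\<^sup>2)" for z
  proof -
    have *: "norm (U z * cnj (U (cnj z))) \<le> M\<^sup>2 * exp (2 * B * (Im z)\<^sup>2)"
      if "\<And>z. norm (U z) \<le> M * exp (B * (Im z)\<^sup>2 + \<kappa> * Im z)" for U M
    proof -
      have "norm (U z * cnj (U (cnj z))) \<le>
          (M * exp (B * (Im z)\<^sup>2 + \<kappa> * Im z)) * (M * exp (B * (Im (cnj z))\<^sup>2 + \<kappa> * Im (cnj z)))"
        unfolding norm_mult complex_mod_cnj
        by (intro mult_mono that norm_ge_zero order_trans[OF norm_ge_zero that])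
      also have "\<dots> = M\<^sup>2 * (exp (B * (Im z)\<^sup>2 + \<kappa> * Im z) * exp (B * (Im (cnj z))\<^sup>2 + \<kappa> * Im (cnj z)))"
        by (simp add: power2_eq_square)
      also have "\<dots> = M\<^sup>2 * exp (2 * B * (Im z)\<^sup>2)"
        unfolding exp_add[symmetric] by simp
      finally show ?thesis .
    qed
    show ?thesis
      unfolding H_def distrib_right
      by (intro order_trans[OF norm_triangle_ineq4] add_mono * boundV boundW)
  qed
  have zH: "H (of_real (\<tau> * sqrt (real n))) = 0" "H (of_real (- \<tau> * sqrt (real n))) = 0" for n
    unfolding H_real eq by (simp_all only: diff_self of_real_0)
  have "H (of_real r) = 0"
    using B by (intro entire_eq_0_of_sqrt_zeros[OF holH boundH _ \<tau> zH]) linarith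
  then have "(norm (V (of_real r)))\<^sup>2 = (norm (W (of_real r)))\<^sup>2"
    unfolding H_real of_real_eq_0_iff by (simp only: right_minus_eq)
  then show ?thesis by (rule power2_eq_imp_eq) (rule norm_ge_zero)+
qed

text \<open>A majorant for the functions alone suffices: by Cauchy's inequality it also bounds their
  derivatives on a smaller disc, hence the difference quotients. Dominated convergence then
  differentiates under the integral.\<close>

lemma holomorphic_integral_parameter:
  fixes F :: "'a \<Rightarrow> complex \<Rightarrow> complex"
  assumes hol: "\<And>t. F t holomorphic_on UNIV"
    and meas: "\<And>z. (\<lambda>t. F t z) \<in> borel_measurable M"
    and dom: "\<And>R. \<exists>g. integrable M g \<and> (\<forall>t z. norm z \<le> R \<longrightarrow> norm (F t z) \<le> g t)"
  shows "(\<lambda>z. \<integral>t. F t z \<partial>M) holomorphic_on UNIV"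
proof -
  have intF: "integrable M (\<lambda>t. F t z)" for z
  proof -
    obtain g where "integrable M g" "\<And>t. norm (F t z) \<le> g t"
      using dom[of "norm z"] by auto
    then show ?thesis
      using meas by (auto intro!: Bochner_Integration.integrable_bound[of M g] simp: order_trans[OF _ abs_ge_self])
  qed
  have "\<exists>D. ((\<lambda>z. \<integral>t. F t z \<partial>M) has_field_derivative D) (at z)" for z
  proof -
    \<comment> \<open>The margin 2 is one unit for points \<open>y\<close> near \<open>z\<close> and
      one for the Cauchy circles of radius 1 around them.\<close>
    obtain g where g: "integrable M g" "\<And>t y. norm y \<le> norm z + 2 \<Longrightarrow> norm (F t y) \<le> g t"
      using dom[of "norm z + 2"] by auto
    have der: "(F t has_field_derivative deriv (F t) y) (at y within S)" for t y S
      using hol[of t] by (auto intro!: holomorphic_derivI[of _ UNIV])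
    have derb: "norm (deriv (F t) y) \<le> g t" if "y \<in> cball z 1" for t y
    proof -
      have "norm ((deriv ^^ 1) (F t) y) \<le> fact 1 * g t / 1 ^ 1"
      proof (rule Cauchy_inequality)
        fix x assume "norm (y - x) = 1"
        then have "norm x \<le> norm z + 2"
          using that norm_triangle_ineq3[of x y] norm_triangle_ineq3[of z y] 
          by (simp add: dist_norm norm_minus_commute)
        then show "norm (F t x) \<le> g t" by (rule g)
      qed (use hol[of t] in \<open>auto intro: holomorphic_on_subset holomorphic_on_imp_continuous_on\<close>)
      then show ?thesis by simp
    qed
    have lip: "norm ((F t y - F t z) / (y - z)) \<le> g t" if "y \<in> cball z 1" "y \<noteq> z" for t y
    proof -
      have "norm (F t y - F t z) \<le> g t * norm (y - z)"
        by (rule field_differentiable_bound[of "cball z 1" "F t" "deriv (F t)"])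
           (use der derb that in auto)
      then show ?thesis
        using that by (simp add: norm_divide field_simps)
    qed
    have "((\<lambda>y. ((\<integral>t. F t y \<partial>M) - (\<integral>t. F t z \<partial>M)) / (y - z)) \<longlongrightarrow> (\<integral>t. deriv (F t) z \<partial>M)) (at z)"
      unfolding tendsto_at_iff_sequentially comp_def
    proof (intro allI impI)
      fix X assume X: "\<forall>i. X i \<in> UNIV - {z}" "X \<longlonglongrightarrow> z"
      have ev: "\<forall>\<^sub>F i in sequentially. X i \<in> cball z 1"
        using X(2) by (metis (no_types, lifting) dist_commute eventually_mono less_eq_real_def mem_cball tendstoD zero_less_one)
      then obtain k where k: "\<And>i. i \<ge> k \<Longrightarrow> X i \<in> cball z 1"
        by (auto simp: eventually_sequentially)
      have lim: "(\<lambda>i. (F t (X i) - F t z) / (X i - z)) \<longlonglongrightarrow> deriv (F t) z" for t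
        using der[of t z UNIV] X unfolding has_field_derivative_iff tendsto_at_iff_sequentially comp_def
        by auto
      \<comment> \<open>The majorant holds only once the sequence has entered the unit disc around
        \<open>z\<close>, hence the shift by \<open>k\<close>.\<close>
      have "(\<lambda>i. \<integral>t. (F t (X (i + k)) - F t z) / (X (i + k) - z) \<partial>M) \<longlonglongrightarrow> (\<integral>t. deriv (F t) z \<partial>M)"
      proof (rule integral_dominated_convergence[where w=g])
        show "(\<lambda>t. deriv (F t) z) \<in> borel_measurable M"
          by (rule borel_measurable_LIMSEQ_metric[OF _ lim]) (use meas in auto)
        show "AE t in M. (\<lambda>i. (F t (X (i + k)) - F t z) / (X (i + k) - z)) \<longlonglongrightarrow> deriv (F t) z"
          using LIMSEQ_ignore_initial_segment[OF lim] by auto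
        show "AE t in M. norm ((F t (X (i + k)) - F t z) / (X (i + k) - z)) \<le> g t" for i
          using lip k X(1) by auto
      qed (use meas g(1) in auto)
      moreover have "(\<integral>t. (F t y - F t z) / (y - z) \<partial>M) = ((\<integral>t. F t y \<partial>M) - (\<integral>t. F t z \<partial>M)) / (y - z)" for y
        using intF by simp
      ultimately have "(\<lambda>i. ((\<integral>t. F t (X (i + k)) \<partial>M) - (\<integral>t. F t z \<partial>M)) / (X (i + k) - z)) \<longlonglongrightarrow> (\<integral>t. deriv (F t) z \<partial>M)"
        by (simp only:)
      then show "(\<lambda>i. ((\<integral>t. F t (X i) \<partial>M) - (\<integral>t. F t z \<partial>M)) / (X i - z)) \<longlonglongrightarrow> (\<integral>t. deriv (F t) z \<partial>M)"
        by (rule LIMSEQ_offset)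
    qed
    then show ?thesis
      unfolding has_field_derivative_iff by blast
  qed
  then show ?thesis
    by (metis field_differentiable_at_within field_differentiable_def holomorphic_onI)
qed

section \<open>Injectivity of the Fourier transform on integrable functions\<close>

lemma integrable_times_iexp [intro]:
  fixes u :: "'a \<Rightarrow> complex"
  assumes "integrable M u" "X \<in> borel_measurable M"
  shows "integrable M (\<lambda>t. u t * iexp (X t))"
  using assms by (auto intro!: Bochner_Integration.integrable_bound[OF assms(1)] simp: norm_mult)

text \<open>The positive and negative parts of \<open>u\<close> have equal mass, by the hypothesis
  at frequency 0. Normalised and pushed forward along \<open>X\<close>, they become probability
  distributions on the line with the same characteristic function, so Levy's theorem identifies
  them.\<close>

lemma integral_indicator_eq_0_of_iexp_real:
  fixes u X :: "'a \<Rightarrow> real"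
  assumes u: "integrable M u" and X[measurable]: "X \<in> borel_measurable M"
    and zero: "\<And>\<omega>. (\<integral>t. complex_of_real (u t) * iexp (\<omega> * X t) \<partial>M) = 0"
    and A[measurable]: "A \<in> sets borel"
  shows "(\<integral>t. indicator A (X t) * u t \<partial>M) = 0"
proof -
  note [measurable] = borel_measurable_integrable[OF u]
  define p where "p t = max 0 (u t)" for t
  define n where "n t = max 0 (- u t)" for t
  have int: "integrable M p" "integrable M n"
    unfolding p_def[abs_def] n_def[abs_def] using u by auto
  note [measurable] = borel_measurable_integrable[OF int(1)] borel_measurable_integrable[OF int(2)]
  have nn: "0 \<le> p t" "0 \<le> n t" and u_eq: "u t = p t - n t" for t
    by (auto simp: p_def n_def)
  define m where "m = (\<integral>t. p t \<partial>M)"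
  have "complex_of_real (\<integral>t. u t \<partial>M) = 0"
    using zero[of 0] by simp
  then have m': "(\<integral>t. n t \<partial>M) = m"
    using int by (simp add: u_eq m_def)
  have m0: "0 \<le> m" unfolding m_def using nn by (intro integral_nonneg_AE) auto
  show ?thesis
  \<comment> \<open>Mass 0 cannot be normalised, but then \<open>u\<close> vanishes almost
    everywhere.\<close>
  proof (cases "m = 0")
    case True
    then have "AE t in M. p t = 0" "AE t in M. n t = 0"
      using int nn m' m_def integral_nonneg_eq_0_iff_AE[OF int(1)] integral_nonneg_eq_0_iff_AE[OF int(2)]
      by auto
    then have "AE t in M. indicator A (X t) * u t = 0"
      by eventually_elim (simp add: u_eq)
    then show ?thesis by (rule integral_eq_zero_AE)
  next
    case False
    then have m: "0 < m" using m0 by simp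
    define N where "N w = distr (density M (\<lambda>t. ennreal (w t / m))) borel X" for w :: "'a \<Rightarrow> real"
    have pr: "real_distribution (N w)" and ch: "char (N w) \<omega> = (\<integral>t. of_real (w t / m) * iexp (\<omega> * X t) \<partial>M)"
      and me: "measure (N w) A = (\<integral>t. w t / m * indicator A (X t) \<partial>M)"
      if w: "integrable M w" "\<And>t. 0 \<le> w t" "(\<integral>t. w t \<partial>M) = m" for w \<omega>
    proof -
      note [measurable] = borel_measurable_integrable[OF w(1)]
      have "(\<integral>\<^sup>+ t. ennreal (w t / m) \<partial>M) = ennreal (\<integral>t. w t / m \<partial>M)"
        using w m by (intro nn_integral_eq_integral) auto
      then have "prob_space (density M (\<lambda>t. ennreal (w t / m)))"
        using w m by (intro prob_spaceI) (simp add: emeasure_density cong: nn_integral_cong)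
      then have "prob_space (N w)"
        unfolding N_def by (intro prob_space.prob_space_distr) auto
      then show "real_distribution (N w)"
        by (simp add: real_distribution_def real_distribution_axioms_def N_def)
      show "char (N w) \<omega> = (\<integral>t. of_real (w t / m) * iexp (\<omega> * X t) \<partial>M)"
        unfolding char_def N_def using w m
        by (subst integral_distr) (auto simp: integral_density scaleR_conv_of_real)
      have "measure (N w) A = (\<integral>x. indicator A x \<partial>(N w))"
        by (simp add: N_def)
      also have "\<dots> = (\<integral>t. w t / m * indicator A (X t) \<partial>M)"
        unfolding N_def using w m by (subst integral_distr) (auto simp: integral_density)
      finally show "measure (N w) A = (\<integral>t. w t / m * indicator A (X t) \<partial>M)" .
    qed
    have "char (N p) = char (N n)"
    proof
      fix \<omega>
      have I: "integrable M (\<lambda>t. complex_of_real (p t) * iexp (\<omega> * X t))"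
        "integrable M (\<lambda>t. complex_of_real (n t) * iexp (\<omega> * X t))"
        by (intro integrable_times_iexp integrable_of_real int borel_measurable_times borel_measurable_const X)+
      have "(\<integral>t. complex_of_real (p t) * iexp (\<omega> * X t) \<partial>M) = (\<integral>t. complex_of_real (n t) * iexp (\<omega> * X t) \<partial>M)"
        using zero[of \<omega>] I by (simp add: u_eq left_diff_distrib)
      then show "char (N p) \<omega> = char (N n) \<omega>"
        using int nn m' by (simp add: ch m_def)
    qed
    then have "N p = N n"
      using int nn m' by (intro Levy_uniqueness pr) (auto simp: m_def)
    then have "(\<integral>t. p t / m * indicator A (X t) \<partial>M) = (\<integral>t. n t / m * indicator A (X t) \<partial>M)"
      using me[OF int(1) nn(1) m_def[symmetric]] me[OF int(2) nn(2) m'] by metis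
    moreover have "integrable M (\<lambda>t. w t / m * indicator A (X t))" if "integrable M w" for w
    proof (rule Bochner_Integration.integrable_bound)
      show "integrable M (\<lambda>t. w t / m)" using that m by simp
      show "(\<lambda>t. w t / m * indicator A (X t)) \<in> borel_measurable M" using that by measurable
    qed (auto split: split_indicator)
    ultimately have "(\<integral>t. p t / m * indicator A (X t) - n t / m * indicator A (X t) \<partial>M) = 0"
      using int by simp
    then have "(\<integral>t. (indicator A (X t) * u t) / m \<partial>M) = 0"
      by (simp add: u_eq diff_divide_distrib algebra_simps)
    then show ?thesis using m by simp
  qed
qed

text \<open>The hypothesis for \<open>cnj u\<close> is the conjugate of that for \<open>u\<close> at
  the opposite frequency. It therefore passes to the real and imaginary parts, which the real case
  handles.\<close>

lemma integral_indicator_eq_0_of_iexp: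
  fixes u :: "'a \<Rightarrow> complex" and X :: "'a \<Rightarrow> real"
  assumes u: "integrable M u" and X[measurable]: "X \<in> borel_measurable M"
    and zero: "\<And>\<omega>. (\<integral>t. u t * iexp (\<omega> * X t) \<partial>M) = 0"
    and A[measurable]: "A \<in> sets borel"
  shows "(\<integral>t. indicator A (X t) * u t \<partial>M) = 0"
proof -
  have I: "integrable M (\<lambda>t. u t * iexp (\<omega> * X t))" "integrable M (\<lambda>t. cnj (u t) * iexp (\<omega> * X t))" for \<omega>
    by (intro integrable_times_iexp integrable_cnj u borel_measurable_times borel_measurable_const X)+
  have zero': "(\<integral>t. cnj (u t) * iexp (\<omega> * X t) \<partial>M) = 0" for \<omega>
  proof -
    have "(\<integral>t. cnj (u t) * iexp (\<omega> * X t) \<partial>M) = cnj (\<integral>t. u t * iexp ((- \<omega>) * X t) \<partial>M)"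
      by (subst Bochner_Integration.integral_cnj[symmetric]) (simp add: exp_cnj)
    then show ?thesis unfolding zero by simp
  qed
  have "(\<integral>t. complex_of_real (Re (u t)) * iexp (\<omega> * X t) \<partial>M) = 0" for \<omega>
  proof -
    have eq: "complex_of_real (Re (u t)) * iexp (\<omega> * X t) = (u t * iexp (\<omega> * X t) + cnj (u t) * iexp (\<omega> * X t)) / 2" for t
      by (simp add: complex_add_cnj flip: distrib_right)
    show ?thesis
      unfolding eq Bochner_Integration.integral_divide_zero
      by (subst Bochner_Integration.integral_add[OF I(1)[of \<omega>] I(2)[of \<omega>]]) (simp only: zero zero', simp)
  qed
  then have R: "(\<integral>t. indicator A (X t) * Re (u t) \<partial>M) = 0"
    using u by (intro integral_indicator_eq_0_of_iexp_real) auto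
  have "(\<integral>t. complex_of_real (Im (u t)) * iexp (\<omega> * X t) \<partial>M) = 0" for \<omega>
  proof -
    have eq: "complex_of_real (Im (u t)) * iexp (\<omega> * X t) = (u t * iexp (\<omega> * X t) - cnj (u t) * iexp (\<omega> * X t)) / (2 * \<i>)" for t
    proof -
      have "u t * E - cnj (u t) * E = (2 * \<i>) * (complex_of_real (Im (u t)) * E)" for E
        by (subst left_diff_distrib[symmetric], subst complex_diff_cnj) simp
      then show ?thesis by (simp only:) (rule nonzero_mult_div_cancel_left[symmetric], simp)
    qed
    show ?thesis
      unfolding eq Bochner_Integration.integral_divide_zero
      by (subst Bochner_Integration.integral_diff[OF I(1)[of \<omega>] I(2)[of \<omega>]]) (simp only: zero zero', simp)
  qed
  then have Im: "(\<integral>t. indicator A (X t) * Im (u t) \<partial>M) = 0"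
    using u by (intro integral_indicator_eq_0_of_iexp_real) auto
  have int: "integrable M (\<lambda>t. indicator A (X t) * u t)"
    using u by (auto intro!: Bochner_Integration.integrable_bound[OF u] split: split_indicator)
  have *: "Re (indicator A (X t) * u t) = indicator A (X t) * Re (u t)"
       "Im (indicator A (X t) * u t) = indicator A (X t) * Im (u t)" for t
    by (auto split: split_indicator)
  show ?thesis
    by (rule complex_eqI; simp only: integral_Re[OF int, symmetric] integral_Im[OF int, symmetric] * R Im; simp)
qed

text \<open>The coordinates are passed from characters to indicators one at a time, each step being the
  one-dimensional uniqueness theorem of Levy.\<close>

lemma integral_eq_0_of_iexp_sets:
  fixes u :: "real^'n \<Rightarrow> complex"
  assumes u: "integrable lborel u"
    and zero: "\<And>\<omega>. (\<integral>t. u t * iexp (\<omega> \<bullet> t) \<partial>lborel) = 0"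
    and A[measurable]: "\<And>j. A j \<in> sets borel"
  shows "(\<integral>t. (\<Prod>j\<in>S. indicator (A j) (t$j)) * u t * iexp (\<Sum>j\<in>-S. \<omega> j * t$j) \<partial>lborel) = 0"
  using finite[of S]
proof (induction S arbitrary: \<omega> rule: finite_induct)
  case empty
  then show ?case
    using zero[of "\<chi> j. \<omega> j"] by (simp add: inner_vec_def)
next
  case (insert k S)
  note [measurable] = borel_measurable_integrable[OF u]
  \<comment> \<open>The indicators already obtained and the characters still left are absorbed into
    the integrand, so that only coordinate \<open>k\<close> acts as the random variable.\<close>
  let ?u = "\<lambda>t. (\<Prod>j\<in>S. indicator (A j) (t$j)) * u t * iexp (\<Sum>j\<in>-insert k S. \<omega> j * t$j)"
  have ind: "norm (\<Prod>j\<in>S. indicator (A j) (t$j) :: complex) \<le> 1" for t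
    unfolding prod_norm[symmetric] by (intro prod_le_1) (auto split: split_indicator)
  have "integrable lborel ?u"
    by (rule Bochner_Integration.integrable_bound[OF u])
       (auto simp: norm_mult intro!: mult_left_le_one_le ind)
  moreover have "(\<integral>t. ?u t * iexp (\<theta> * t$k) \<partial>lborel) = 0" for \<theta>
  proof -
    \<comment> \<open>The induction hypothesis holds for every frequency vector, so slot
      \<open>k\<close> may carry the free frequency \<open>\<theta>\<close>.\<close>
    let ?\<omega> = "\<lambda>j. if j = k then \<theta> else \<omega> j"
    have "(\<Sum>j\<in>-S. ?\<omega> j * t$j) = \<theta> * t$k + (\<Sum>j\<in>-insert k S. \<omega> j * t$j)" for t
    proof -
      have "- S - {k} = - insert k S" by auto
      then have "(\<Sum>j\<in>-S. ?\<omega> j * t$j) = \<theta> * t$k + (\<Sum>j\<in>-insert k S. ?\<omega> j * t$j)"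
        using insert by (subst sum.remove[of "- S" k]) auto
      also have "(\<Sum>j\<in>-insert k S. ?\<omega> j * t$j) = (\<Sum>j\<in>-insert k S. \<omega> j * t$j)"
        by (rule sum.cong) auto
      finally show ?thesis .
    qed
    then show ?thesis
      using insert.IH[of ?\<omega>] by (simp add: distrib_left exp_add mult_ac)
  qed
  ultimately have "(\<integral>t. indicator (A k) (t$k) * ?u t \<partial>lborel) = 0"
    by (intro integral_indicator_eq_0_of_iexp) auto
  then show ?case
    using insert by (simp add: mult_ac)
qed

text \<open>The integral of \<open>u\<close> over a box vanishes by the preceding lemma, since the
  indicator of a box is a product of interval indicators. Boxes are closed under intersection and
  generate the Borel sets, so a Dynkin induction gives all Borel sets.\<close>

theorem fourier_uniqueness:
  fixes u :: "real^'n \<Rightarrow> complex"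
  assumes u: "integrable lborel u"
    and zero: "\<And>\<omega>. (\<integral>t. u t * iexp (\<omega> \<bullet> t) \<partial>lborel) = 0"
  shows "AE t in lborel. u t = 0"
proof (rule sigma_finite_measure.density_zero[OF sigma_finite_lborel u])
  have sint: "set_integrable lborel A u" if "A \<in> sets borel" for A
    using u that unfolding set_integrable_def by (intro integrable_mult_indicator) auto
  fix A :: "(real^'n) set" assume "A \<in> sets lborel"
  then have A: "A \<in> sigma_sets UNIV (range (\<lambda>(a, b). box a b))"
    by (simp add: borel_eq_box)
  have "Int_stable (range (\<lambda>(a, b). box a b :: (real^'n) set))"
    by (auto simp: Int_stable_def box_Int_box)
  moreover have "range (\<lambda>(a, b). box a b :: (real^'n) set) \<subseteq> Pow UNIV" by simp
  ultimately show "set_lebesgue_integral lborel A u = 0"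
    using A
  proof (induction rule: sigma_sets_induct_disjoint)
    case (basic A)
    then obtain a b where A: "A = box a b" by auto
    have "(\<Prod>j\<in>UNIV. indicator {a$j<..<b$j} (t$j)) = (indicator A t :: complex)" for t
    proof (cases "t \<in> A")
      case True
      then show ?thesis by (auto simp: A mem_box_cart)
    next
      case False
      then obtain j where "t$j \<notin> {a$j<..<b$j}" by (auto simp: A mem_box_cart)
      then have "\<exists>j\<in>UNIV. indicator {a$j<..<b$j} (t$j) = (0::complex)" by (intro bexI[of _ j]) auto
      then have "(\<Prod>j\<in>UNIV. indicator {a$j<..<b$j} (t$j)) = (0::complex)" by (intro prod_zero) auto
      then show ?thesis using False by simp
    qed
    then have "(\<integral>t. indicator A t * u t \<partial>lborel) = 0"
      using integral_eq_0_of_iexp_sets[OF u zero, of "\<lambda>j. {a$j<..<b$j}" UNIV] by simp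
    then show ?case
      by (simp add: set_lebesgue_integral_def scaleR_conv_of_real of_real_indicator)
  next
    case empty
    then show ?case by (simp add: set_lebesgue_integral_def)
  next
    case (compl A)
    then have A: "A \<in> sets borel" by (simp add: borel_eq_box)
    have "set_lebesgue_integral lborel (A \<union> (UNIV - A)) u =
      set_lebesgue_integral lborel A u + set_lebesgue_integral lborel (UNIV - A) u"
      using A by (intro set_integral_Un sint) auto
    \<comment> \<open>Complements need the total integral, which is the transform at frequency
      0.\<close>
    moreover have "set_lebesgue_integral lborel UNIV u = 0"
      using zero[of 0] by (simp add: set_lebesgue_integral_def)
    ultimately show ?case using compl by simp
  next
    case (union A)
    then have A: "A i \<in> sets borel" for i by (auto simp: borel_eq_box)
    have "set_lebesgue_integral lborel (\<Union>i. A i) u = (\<Sum>i. set_lebesgue_integral lborel (A i) u)"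
      using A union(1) by (intro lebesgue_integral_countable_add sint) (auto simp: disjoint_family_on_def)
    then show ?case using union by simp
  qed
qed

section \<open>Reflections, translations and correlations of integrable functions\<close>

lemma lborel_distr_minus_left:
  fixes c :: "'a::euclidean_space"
  shows "distr lborel borel (\<lambda>s. c - s) = lborel"
  by (subst (2) lborel_affine[of "-1" c]) (auto simp: density_1)

lemma
  fixes c :: "'a::euclidean_space" and f :: "'a \<Rightarrow> 'b::{banach, second_countable_topology}"
  assumes [measurable]: "f \<in> borel_measurable borel"
  shows lborel_integral_minus_left: "(\<integral>s. f (c - s) \<partial>lborel) = (\<integral>s. f s \<partial>lborel)"
    and lborel_integrable_minus_left: "integrable lborel (\<lambda>s. f (c - s)) \<longleftrightarrow> integrable lborel f"
    and lborel_integral_translate: "(\<integral>s. f (s - c) \<partial>lborel) = (\<integral>s. f s \<partial>lborel)"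
    and lborel_integrable_translate: "integrable lborel (\<lambda>s. f (s - c)) \<longleftrightarrow> integrable lborel f"
proof -
  show "(\<integral>s. f (c - s) \<partial>lborel) = (\<integral>s. f s \<partial>lborel)"
    by (subst (2) lborel_distr_minus_left[of c, symmetric], subst integral_distr) auto
  show "integrable lborel (\<lambda>s. f (c - s)) \<longleftrightarrow> integrable lborel f"
    by (subst (2) lborel_distr_minus_left[of c, symmetric], subst integrable_distr_eq) auto
  show "(\<integral>s. f (s - c) \<partial>lborel) = (\<integral>s. f s \<partial>lborel)"
    by (subst (2) lborel_distr_plus[of "- c", symmetric], subst integral_distr) auto
  show "integrable lborel (\<lambda>s. f (s - c)) \<longleftrightarrow> integrable lborel f"
    by (subst (2) lborel_distr_plus[of "- c", symmetric], subst integrable_distr_eq) auto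
qed

lemma integrable_pair_correlation:
  fixes u v :: "'a::euclidean_space \<Rightarrow> complex"
  assumes u: "integrable lborel u" and v: "integrable lborel v"
  shows "integrable (lborel \<Otimes>\<^sub>M lborel) (\<lambda>(t, s). u t * v (t - s))"
proof (rule lborel_pair.Fubini_integrable)
  have [measurable]: "u \<in> borel_measurable borel" "v \<in> borel_measurable borel"
    using u v by auto
  show "(\<lambda>(t, s). u t * v (t - s)) \<in> borel_measurable (lborel \<Otimes>\<^sub>M lborel)"
    by measurable
  have "(\<integral>s. norm (u t * v (t - s)) \<partial>lborel) = norm (u t) * (\<integral>s. norm (v s) \<partial>lborel)" for t
    by (simp add: norm_mult lborel_integral_minus_left[of "\<lambda>s. norm (v s)"])
  then show "integrable lborel (\<lambda>t. \<integral>s. norm (case (t, s) of (t, s) \<Rightarrow> u t * v (t - s)) \<partial>lborel)"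
    using u by simp
  show "AE t in lborel. integrable lborel (\<lambda>s. case (t, s) of (t, s) \<Rightarrow> u t * v (t - s))"
    using v by (auto simp: lborel_integrable_minus_left)
qed

text \<open>After Fubini, the substitution of \<open>t - s\<close> for \<open>s\<close> splits the
  character into two factors, the second at the opposite frequency. For \<open>v = cnj u\<close> the
  right-hand side is a squared modulus, which links spectrograms to autocorrelations.\<close>

lemma fourier_correlation:
  fixes u v :: "'a::euclidean_space \<Rightarrow> complex"
  assumes u: "integrable lborel u" and v: "integrable lborel v"
  shows "(\<integral>s. (\<integral>t. u t * v (t - s) \<partial>lborel) * iexp (\<omega> \<bullet> s) \<partial>lborel)
    = (\<integral>t. u t * iexp (\<omega> \<bullet> t) \<partial>lborel) * (\<integral>t. v t * iexp (- (\<omega> \<bullet> t)) \<partial>lborel)"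
proof -
  have [measurable]: "u \<in> borel_measurable borel" "v \<in> borel_measurable borel"
    using u v by auto
  have "integrable (lborel \<Otimes>\<^sub>M lborel) (\<lambda>x. (case x of (t, s) \<Rightarrow> u t * v (t - s)) * iexp (\<omega> \<bullet> snd x))"
    by (intro integrable_times_iexp integrable_pair_correlation u v) measurable
  then have int: "integrable (lborel \<Otimes>\<^sub>M lborel) (\<lambda>(t, s). u t * v (t - s) * iexp (\<omega> \<bullet> s))"
    by (simp add: case_prod_beta')
  have "(\<integral>s. (\<integral>t. u t * v (t - s) \<partial>lborel) * iexp (\<omega> \<bullet> s) \<partial>lborel)
      = (\<integral>s. (\<integral>t. u t * v (t - s) * iexp (\<omega> \<bullet> s) \<partial>lborel) \<partial>lborel)"
    by simp
  also have "\<dots> = (\<integral>t. (\<integral>s. u t * v (t - s) * iexp (\<omega> \<bullet> s) \<partial>lborel) \<partial>lborel)"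
    by (rule lborel_pair.Fubini_integral[OF int])
  also have "\<dots> = (\<integral>t. u t * iexp (\<omega> \<bullet> t) * (\<integral>s. v s * iexp (- (\<omega> \<bullet> s)) \<partial>lborel) \<partial>lborel)"
  proof (intro Bochner_Integration.integral_cong refl)
    fix t
    have "(\<integral>s. u t * v (t - s) * iexp (\<omega> \<bullet> s) \<partial>lborel)
        = (\<integral>s. (\<lambda>s. u t * v s * iexp (\<omega> \<bullet> (t - s))) (t - s) \<partial>lborel)"
      by simp
    also have "\<dots> = (\<integral>s. u t * v s * iexp (\<omega> \<bullet> (t - s)) \<partial>lborel)"
      by (rule lborel_integral_minus_left) measurable
    also have "\<dots> = (\<integral>s. (u t * iexp (\<omega> \<bullet> t)) * (v s * iexp (- (\<omega> \<bullet> s))) \<partial>lborel)"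
      by (intro Bochner_Integration.integral_cong refl)
         (simp add: inner_diff_right right_diff_distrib exp_diff exp_minus field_simps)
    finally show "(\<integral>s. u t * v (t - s) * iexp (\<omega> \<bullet> s) \<partial>lborel)
        = u t * iexp (\<omega> \<bullet> t) * (\<integral>s. v s * iexp (- (\<omega> \<bullet> s)) \<partial>lborel)"
      by simp
  qed
  finally show ?thesis by simp
qed

section \<open>Gaussian bounds and entire windows\<close>

definition gauss :: "real^'n \<Rightarrow> real^'n \<Rightarrow> real" where
  "gauss c t = exp (- (\<Sum>j\<in>UNIV. c$j * (t$j)\<^sup>2))"

lemma gauss_pos [simp]: "0 < gauss c t" and gauss_nonneg [simp]: "0 \<le> gauss c t"
  by (simp_all add: gauss_def)

lemma gauss_le_1: "(\<And>j. 0 \<le> c$j) \<Longrightarrow> gauss c t \<le> 1"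
  by (auto simp: gauss_def intro!: sum_nonneg mult_nonneg_nonneg)

lemma gauss_measurable [measurable]: "gauss c \<in> borel_measurable borel"
  unfolding gauss_def[abs_def] by measurable

lemma gauss_square: "(gauss c t)\<^sup>2 = gauss (2 *\<^sub>R c) t"
  by (simp add: gauss_def sum_distrib_left mult.assoc flip: exp_of_nat_mult)

lemma integrable_exp_neg_square:
  fixes c :: real
  assumes "0 < c"
  shows "integrable lborel (\<lambda>x. exp (- (c * x\<^sup>2)))"
proof -
  define \<sigma> where "\<sigma> = 1 / sqrt (2 * c)"
  have \<sigma>: "0 < \<sigma>" "2 * \<sigma>\<^sup>2 = 1 / c"
    using assms by (auto simp: \<sigma>_def power_divide)
  have "exp (- (c * x\<^sup>2)) = sqrt (2 * pi * \<sigma>\<^sup>2) * normal_density 0 \<sigma> x" for x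
    using \<sigma>(1) by (simp add: normal_density_def \<sigma>(2))
  then show ?thesis
    using integrable_normal_density[OF \<sigma>(1), of 0] by simp
qed

lemma integrable_gauss:
  fixes c :: "real^'n"
  assumes c: "\<And>j. 0 < c$j"
  shows "integrable lborel (gauss c)"
proof (rule integrableI_nonneg)
  have B: "(Basis :: (real^'n) set) = range (\<lambda>j. axis j 1)"
    by (auto simp: Basis_vec_def)
  have inj: "inj (\<lambda>j::'n. axis j (1::real))"
    by (auto simp: inj_def axis_eq_axis)
  have cb: "0 < c \<bullet> b" if "b \<in> Basis" for b
    using that c by (auto simp: B inner_axis)
  have "gauss c t = (\<Prod>b\<in>Basis. exp (- ((c \<bullet> b) * (t \<bullet> b)\<^sup>2)))" for t
    unfolding B prod.reindex[OF inj] by (simp add: gauss_def inner_axis sum_negf[symmetric] exp_sum)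
  then have "(\<integral>\<^sup>+ t. ennreal (gauss c t) \<partial>lborel) =
      (\<integral>\<^sup>+ t. (\<Prod>b\<in>Basis. ennreal (exp (- ((c \<bullet> b) * (t \<bullet> b)\<^sup>2)))) \<partial>lborel)"
    by (simp add: prod_ennreal)
  also have "\<dots> = (\<Prod>b\<in>Basis. (\<integral>\<^sup>+ x. ennreal (exp (- ((c \<bullet> b) * x\<^sup>2))) \<partial>lborel))"
    by (rule nn_integral_lborel_prod) auto
  also have "\<dots> = (\<Prod>b\<in>Basis. ennreal (\<integral>x. exp (- ((c \<bullet> b) * x\<^sup>2)) \<partial>lborel))"
    using cb by (intro prod.cong refl nn_integral_eq_integral integrable_exp_neg_square) auto
  also have "\<dots> < \<infinity>"
    by (simp add: prod_ennreal)
  finally show "(\<integral>\<^sup>+ t. ennreal (gauss c t) \<partial>lborel) < \<infinity>" .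
qed auto

text \<open>Follows from \<open>(t - 2 * y)\<^sup>2 \<ge> 0\<close> in each coordinate. Giving up
  half of the decay yields one majorant for all centres in a bounded box, as needed for holomorphy
  of parameter integrals.\<close>

lemma gauss_diff_le:
  assumes c: "\<And>j. 0 \<le> c$j" and y: "\<And>j. \<bar>y$j\<bar> \<le> M j"
  shows "gauss c (t - y) \<le> exp (\<Sum>j\<in>UNIV. c$j * (M j)\<^sup>2) * gauss ((1/2) *\<^sub>R c) t"
proof -
  have "c$j * (t$j)\<^sup>2 / 2 \<le> c$j * (M j)\<^sup>2 + c$j * (t$j - y$j)\<^sup>2" for j
  proof -
    have "(y$j)\<^sup>2 \<le> (M j)\<^sup>2"
      using y[of j] by (meson abs_ge_zero abs_le_square_iff order_trans abs_ge_self)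
    moreover have "0 \<le> (t$j - 2 * y$j)\<^sup>2" by simp
    ultimately have "(t$j)\<^sup>2 / 2 \<le> (M j)\<^sup>2 + (t$j - y$j)\<^sup>2"
      by (simp add: power2_eq_square algebra_simps)
    from mult_left_mono[OF this c[of j]] show ?thesis by (simp add: algebra_simps)
  qed
  then have "(\<Sum>j\<in>UNIV. c$j * (t$j)\<^sup>2 / 2) \<le> (\<Sum>j\<in>UNIV. c$j * (M j)\<^sup>2) + (\<Sum>j\<in>UNIV. c$j * (t$j - y$j)\<^sup>2)"
    unfolding sum.distrib[symmetric] by (rule sum_mono)
  then show ?thesis
    by (simp add: gauss_def sum_divide_distrib flip: exp_add)
qed

text \<open>Completing the square in coordinate \<open>j\<close> trades exponential growth for a
  shifted centre. The price is the growth rate \<open>pi\<^sup>2 / a$j\<close> of the frequency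
  extension.\<close>

lemma gauss_complete_square:
  assumes "a$j \<noteq> 0"
  shows "gauss a w * exp (2 * pi * v * w$j) = exp (pi\<^sup>2 / a$j * v\<^sup>2) * gauss a (w - axis j (pi * v / a$j))"
proof -
  have "a$k * ((w - axis j s)$k)\<^sup>2 = a$k * (w$k)\<^sup>2 + (if k = j then a$j * s\<^sup>2 - 2 * a$j * s * w$j else 0)" for k s
    by (simp add: axis_def power2_eq_square algebra_simps)
  then have "(\<Sum>k\<in>UNIV. a$k * ((w - axis j s)$k)\<^sup>2) = (\<Sum>k\<in>UNIV. a$k * (w$k)\<^sup>2) + (a$j * s\<^sup>2 - 2 * a$j * s * w$j)" for s
    by (simp add: sum.distrib)
  from this[of "pi * v / a$j"] show ?thesis
    unfolding gauss_def exp_add[symmetric] using assms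
    by (simp add: power2_eq_square field_simps)
qed

lemma integrable_mult_of_squares:
  fixes f g :: "'a \<Rightarrow> complex"
  assumes [measurable]: "f \<in> borel_measurable M" "g \<in> borel_measurable M"
    and int: "integrable M (\<lambda>t. (norm (f t))\<^sup>2)" "integrable M (\<lambda>t. (norm (g t))\<^sup>2)"
  shows "integrable M (\<lambda>t. f t * g t)"
proof (rule Bochner_Integration.integrable_bound)
  show "integrable M (\<lambda>t. ((norm (f t))\<^sup>2 + (norm (g t))\<^sup>2) / 2)"
    using int by simp
  have "norm (f t * g t) \<le> norm (((norm (f t))\<^sup>2 + (norm (g t))\<^sup>2) / 2)" for t
    using sum_squares_bound[of "norm (f t)" "norm (g t)"] by (simp add: norm_mult)
  then show "AE t in M. norm (f t * g t) \<le> norm (((norm (f t))\<^sup>2 + (norm (g t))\<^sup>2) / 2)" by simp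
qed measurable

text \<open>The inequality of arithmetic and geometric means splits the product into two squares. By
  translation invariance the resulting bound does not depend on the centre \<open>y\<close>, which
  makes the growth bounds for the transform uniform.\<close>

lemma
  fixes a y :: "real^'n"
  assumes f: "f \<in> L2" and a: "\<And>j. 0 < a$j"
  shows integrable_L2_gauss: "integrable lborel (\<lambda>t. norm (f t) * gauss a (t - y))"
    and integral_L2_gauss_le: "(\<integral>t. norm (f t) * gauss a (t - y) \<partial>lborel) \<le>
      ((\<integral>t. (norm (f t))\<^sup>2 \<partial>lborel) + (\<integral>t. gauss (2 *\<^sub>R a) t \<partial>lborel)) / 2"
proof -
  have [measurable]: "f \<in> borel_measurable borel" and fi: "integrable lborel (\<lambda>t. (norm (f t))\<^sup>2)"
    using f by (auto simp: L2_def)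
  have g: "integrable lborel (gauss (2 *\<^sub>R a))"
    using a by (intro integrable_gauss) auto
  then have g': "integrable lborel (\<lambda>t. gauss (2 *\<^sub>R a) (t - y))"
    by (subst lborel_integrable_translate) auto
  have le: "norm (f t) * gauss a (t - y) \<le> ((norm (f t))\<^sup>2 + gauss (2 *\<^sub>R a) (t - y)) / 2" for t
    using sum_squares_bound[of "norm (f t)" "gauss a (t - y)"] by (simp add: gauss_square)
  have I: "integrable lborel (\<lambda>t. ((norm (f t))\<^sup>2 + gauss (2 *\<^sub>R a) (t - y)) / 2)"
    using fi g' by simp
  show int: "integrable lborel (\<lambda>t. norm (f t) * gauss a (t - y))"
    by (rule Bochner_Integration.integrable_bound[OF I]) (use le in \<open>auto intro!: AE_I2 order_trans[OF _ abs_ge_self] simp: abs_mult\<close>)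
  have "(\<integral>t. norm (f t) * gauss a (t - y) \<partial>lborel) \<le> (\<integral>t. ((norm (f t))\<^sup>2 + gauss (2 *\<^sub>R a) (t - y)) / 2 \<partial>lborel)"
    by (rule integral_mono[OF int I le])
  also have "\<dots> = ((\<integral>t. (norm (f t))\<^sup>2 \<partial>lborel) + (\<integral>t. gauss (2 *\<^sub>R a) t \<partial>lborel)) / 2"
    using fi g' by (simp add: lborel_integral_translate[of "gauss (2 *\<^sub>R a)"])
  finally show "(\<integral>t. norm (f t) * gauss a (t - y) \<partial>lborel) \<le>
      ((\<integral>t. (norm (f t))\<^sup>2 \<partial>lborel) + (\<integral>t. gauss (2 *\<^sub>R a) t \<partial>lborel)) / 2" .
qed

section \<open>Identity theorems and the non-vanishing of the window\<close>

lemma entire_eq_0_of_real_interval: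
  fixes L :: "complex \<Rightarrow> complex"
  assumes L: "L holomorphic_on UNIV" and \<delta>: "0 < \<delta>" and zero: "\<And>r. \<bar>r\<bar> < \<delta> \<Longrightarrow> L (of_real r) = 0"
  shows "L z = 0"
proof (rule analytic_continuation[OF L open_UNIV connected_UNIV subset_UNIV UNIV_I _ _ UNIV_I])
  show "0 islimpt complex_of_real ` {-\<delta><..<\<delta>}"
    unfolding islimpt_approachable
  proof (intro allI impI)
    fix e :: real assume "0 < e"
    then have "min \<delta> e / 2 \<in> {-\<delta><..<\<delta>}" "min \<delta> e / 2 \<noteq> 0" "\<bar>min \<delta> e / 2\<bar> < e"
      using \<delta> by (auto simp: min_def)
    then show "\<exists>x'\<in>complex_of_real ` {-\<delta><..<\<delta>}. x' \<noteq> 0 \<and> dist x' 0 < e"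
      by (intro bexI[OF _ imageI]) (auto simp only: dist_norm diff_zero norm_of_real of_real_eq_0_iff)
  qed
qed (use zero in \<open>auto simp: abs_less_iff\<close>)

text \<open>The product vanishes on the real axis, hence everywhere. Near \<open>w\<close> the
  factor \<open>F\<close> is nonzero, so \<open>G\<close> vanishes on a disc and then
  identically.\<close>

lemma entire_mult_eq_0:
  fixes F G :: "complex \<Rightarrow> complex"
  assumes F: "F holomorphic_on UNIV" and G: "G holomorphic_on UNIV"
    and zero: "\<And>r. F (of_real r) * G (of_real r) = 0" and nz: "F w \<noteq> 0"
  shows "G z = 0"
proof -
  have FG: "F x * G x = 0" for x
    by (rule entire_eq_0_of_real_interval[of "\<lambda>x. F x * G x" 1]) (use F G zero in \<open>auto intro!: holomorphic_intros\<close>)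
  have "isCont F w"
    using holomorphic_on_imp_continuous_on[OF F] by (simp add: continuous_on_eq_continuous_at)
  then obtain e where e: "e > 0" "\<And>y. dist w y < e \<Longrightarrow> F y \<noteq> 0"
    using nz continuous_at_avoid[of w F 0] by auto
  show ?thesis
  proof (rule analytic_continuation_open[of "ball w e" UNIV G "\<lambda>_. 0"])
    show "G x = 0" if "x \<in> ball w e" for x
      using FG[of x] e(2)[of x] that by auto
  qed (use e G in auto)
qed

lemma continuous_AE_eq_0:
  fixes P :: "'a::euclidean_space \<Rightarrow> 'b::real_normed_vector"
  assumes P: "continuous_on UNIV P" and ae: "AE y in lborel. P y = 0"
  shows "P y = 0"
proof -
  have op: "open {y. P y \<noteq> 0}"
    by (intro open_Collect_neq P continuous_on_const)
  then have "{y. P y \<noteq> 0} \<in> null_sets lborel"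
    using ae by (subst AE_iff_null_sets) (auto simp: )
  then have "negligible {y. P y \<noteq> 0}"
    by (simp add: negligible_iff_null_sets null_sets_completionI)
  then show ?thesis
    using open_not_negligible[OF op] by auto
qed

text \<open>Complex linearity of the Frechet derivative turns the chain rule into a complex
  derivative along the line. All uses of several complex variables reduce to such lines.\<close>

lemma entire_cd_line:
  fixes p q :: "complex^'n"
  assumes "entire_cd F"
  shows "(\<lambda>z. F (p + (\<chi> k. z * q$k))) holomorphic_on UNIV"
proof -
  have "\<exists>D. ((\<lambda>z. F (p + (\<chi> k. z * q$k))) has_field_derivative D) (at z)" for z
  proof -
    let ?z = "p + (\<chi> k. z * q$k)"
    obtain D where D: "(F has_derivative D) (at ?z)" "\<And>c v. D (\<chi> j. c * v$j) = c * D v"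
      using assms unfolding entire_cd_def by meson
    have "linear (\<lambda>z. \<chi> k. z * q$k)"
      by (rule linearI) (auto simp: vec_eq_iff algebra_simps)
    then have "((\<lambda>z. p + (\<chi> k. z * q$k)) has_derivative (\<lambda>z. \<chi> k. z * q$k)) (at z)"
      by (auto intro!: derivative_eq_intros linear_imp_has_derivative)
    from diff_chain_at[OF this D(1)]
    have "((\<lambda>z. F (p + (\<chi> k. z * q$k))) has_derivative (\<lambda>h. h * D q)) (at z)"
      by (simp add: o_def D(2))
    then show ?thesis
      by (intro exI[of _ "D q"]) (simp add: has_field_derivative_def mult.commute[of _ "D q"])
  qed
  then show ?thesis
    by (metis field_differentiable_at_within field_differentiable_def holomorphic_onI)
qed

lemma entire_cd_continuous: "entire_cd F \<Longrightarrow> continuous_on S F"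
  unfolding entire_cd_def
  by (meson continuous_at_imp_continuous_on has_derivative_continuous)

lemma continuous_cvec: "continuous_on S (\<lambda>t. cvec (t - y) w)"
  unfolding cvec_def Complex_eq by (intro continuous_intros)

lemma O_ab_bound:
  assumes "\<phi> \<in> O_ab a b"
  obtains C where "C > 0" "\<And>x y. norm (\<phi> (cvec x y)) \<le> C * gauss a x * exp (\<Sum>j\<in>UNIV. b$j * (y$j)\<^sup>2)"
proof -
  obtain C where "C > 0" "\<And>x y. norm (\<phi> (cvec x y)) \<le> C * (\<Prod>j\<in>UNIV. exp (- a$j * (x$j)\<^sup>2) * exp (b$j * (y$j)\<^sup>2))"
    using assms unfolding O_ab_def by blast
  moreover have "(\<Prod>j\<in>UNIV. exp (- a$j * (x$j)\<^sup>2) * exp (b$j * (y$j)\<^sup>2)) = gauss a x * exp (\<Sum>j\<in>UNIV. b$j * (y$j)\<^sup>2)" for x y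
    by (simp add: gauss_def prod.distrib exp_sum sum_negf[symmetric])
  ultimately show thesis
    using that[of C] by (simp add: mult.assoc)
qed

text \<open>This keeps the product \<open>cnj (\<phi> y) * \<phi> (y - s)\<close> of the window with
  its translate from being identically zero on real points, for every shift \<open>s\<close>. Along
  a line in direction \<open>s\<close> both factors are entire and neither is zero, so neither is
  their product on the real axis.\<close>

lemma window_overlap:
  fixes \<phi> :: "complex^'n \<Rightarrow> complex"
  assumes hol: "entire_cd \<phi>" and nz: "\<phi> \<noteq> (\<lambda>_. 0)"
  obtains y where "\<phi> (cvec y 0) \<noteq> 0" "\<phi> (cvec (y - s) 0) \<noteq> 0"
proof -
  have line: "cvec x 0 + (\<chi> k. of_real r * cvec y 0 $ k) = cvec (x + r *\<^sub>R y) 0" for x y :: "real^'n" and r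
    by (simp add: vec_eq_iff cvec_def complex_eq_iff)
  obtain y0 where y0: "\<phi> (cvec y0 0) \<noteq> 0"
  proof (rule ccontr)
    assume "\<not> thesis"
    then have z: "\<phi> (cvec y 0) = 0" for y using that by blast
    have "\<phi> w = 0" for w
    proof -
      \<comment> \<open>The point \<open>w\<close> is reached at parameter \<open>\<i>\<close> on
        the line from its real part in the direction of its imaginary part; at real parameters this
        line stays among real vectors.\<close>
      let ?x = "\<chi> j. Re (w$j)" and ?y = "\<chi> j. Im (w$j)"
      have "\<phi> (cvec ?x 0 + (\<chi> k. \<i> * cvec ?y 0 $ k)) = 0"
        by (rule entire_eq_0_of_real_interval[OF entire_cd_line[OF hol], of 1]) (auto simp: line z)
      moreover have "cvec ?x 0 + (\<chi> k. \<i> * cvec ?y 0 $ k) = w"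
        by (simp add: vec_eq_iff cvec_def complex_eq_iff)
      ultimately show ?thesis by simp
    qed
    then show False using nz by auto
  qed
  \<comment> \<open>\<open>G\<close> is \<open>F\<close> with the parameter shifted by 1, so
    \<open>F 0\<close> and \<open>G 1\<close> are both the value at \<open>y0\<close>.\<close>
  define F where "F z = \<phi> (cvec y0 0 + (\<chi> k. z * cvec s 0 $ k))" for z
  define G where "G z = \<phi> (cvec (y0 - s) 0 + (\<chi> k. z * cvec s 0 $ k))" for z
  have "F 0 \<noteq> 0"
    using y0 line[of y0 0 s] by (simp add: F_def)
  moreover have "G 1 \<noteq> 0"
    using y0 line[of "y0 - s" 1 s] by (simp add: G_def)
  ultimately obtain r where "F (of_real r) * G (of_real r) \<noteq> 0"
    using entire_mult_eq_0[of F G 0 1] entire_cd_line[OF hol] unfolding F_def G_def by blast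
  then have "\<phi> (cvec (y0 + r *\<^sub>R s) 0) \<noteq> 0" "\<phi> (cvec (y0 - s + r *\<^sub>R s) 0) \<noteq> 0"
    by (auto simp: F_def G_def line)
  then show thesis
    using that[of "y0 + r *\<^sub>R s"] by (simp add: algebra_simps)
qed

section \<open>Deconvolution\<close>

lemma continuous_integral_parameter:
  fixes k :: "'b::metric_space \<Rightarrow> 'a \<Rightarrow> complex"
  assumes F: "integrable M F"
    and meas: "\<And>x. k x \<in> borel_measurable M"
    and bound: "\<And>x t. norm (k x t) \<le> B"
    and cont: "\<And>t. continuous_on UNIV (\<lambda>x. k x t)"
  shows "continuous_on UNIV (\<lambda>x. \<integral>t. F t * k x t \<partial>M)"
  unfolding continuous_on_sequentially comp_def
proof (intro allI ballI impI, elim conjE)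
  fix X :: "nat \<Rightarrow> 'b" and x assume X: "X \<longlonglongrightarrow> x"
  note [measurable] = meas borel_measurable_integrable[OF F]
  show "(\<lambda>n. \<integral>t. F t * k (X n) t \<partial>M) \<longlonglongrightarrow> (\<integral>t. F t * k x t \<partial>M)"
  proof (rule integral_dominated_convergence[where w="\<lambda>t. norm (F t) * B"])
    have "(\<lambda>n. k (X n) t) \<longlonglongrightarrow> k x t" for t
      using cont[of t] X by (auto simp: continuous_on_sequentially comp_def)
    then show "AE t in M. (\<lambda>n. F t * k (X n) t) \<longlonglongrightarrow> F t * k x t"
      by (intro AE_I2 tendsto_mult_left)
    show "AE t in M. norm (F t * k (X n) t) \<le> norm (F t) * B" for n
      using bound by (auto simp: norm_mult intro!: mult_left_mono)
  qed (use F in auto)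
qed

text \<open>The transform of \<open>P\<close> extends to an entire function along every line, so it cannot vanish on
  the open set where the transform of \<open>F\<close> does not.\<close>

lemma gaussian_deconvolution:
  fixes F P :: "real^'n \<Rightarrow> complex" and c :: "real^'n"
  assumes F: "integrable lborel F" and P[measurable]: "P \<in> borel_measurable borel"
    and bound: "\<And>y. norm (P y) \<le> C * gauss c y" and c: "\<And>j. 0 < c$j"
    and conv: "\<And>x. (\<integral>t. F t * P (t - x) \<partial>lborel) = 0"
    and nz: "\<not> (AE y in lborel. P y = 0)"
  shows "AE t in lborel. F t = 0"
proof (rule fourier_uniqueness[OF F], rule ccontr)
  fix \<eta> assume ne: "(\<integral>t. F t * iexp (\<eta> \<bullet> t) \<partial>lborel) \<noteq> 0"
  have C: "0 \<le> C"
    using order_trans[OF norm_ge_zero bound[of 0]] by (simp add: zero_le_mult_iff less_le_not_le[THEN iffD1, OF gauss_pos])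
  have Pint: "integrable lborel P"
    by (rule Bochner_Integration.integrable_bound[of _ "\<lambda>y. C * gauss c y"])
       (use integrable_gauss[OF c] bound C in \<open>auto simp: abs_mult\<close>)
  \<comment> \<open>The correlation of \<open>F\<close> with \<open>P\<close> vanishes, hence so
    does the product of their transforms.\<close>
  have prod: "(\<integral>t. F t * iexp (\<omega> \<bullet> t) \<partial>lborel) * (\<integral>y. P y * iexp (- (\<omega> \<bullet> y)) \<partial>lborel) = 0" for \<omega>
    using fourier_correlation[OF F Pint, of \<omega>] by (simp add: conv)
  have W: "(\<integral>y. P y * iexp (- ((\<eta> + v) \<bullet> y)) \<partial>lborel) = 0" for v
  proof -
    \<comment> \<open>The transform of \<open>P\<close> along the complex line from
      \<open>\<eta>\<close> in direction \<open>v\<close>; the parameter 1 gives the frequency to be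
      treated.\<close>
    define L where "L z = (\<integral>y. P y * exp (- (\<i> * of_real (\<eta> \<bullet> y) + \<i> * z * of_real (v \<bullet> y))) \<partial>lborel)" for z
    have "L holomorphic_on UNIV"
      unfolding L_def[abs_def]
    proof (rule holomorphic_integral_parameter)
      fix R :: real
      \<comment> \<open>The exponential grows like
        \<open>R * \<bar>v$j\<bar> * \<bar>y$j\<bar>\<close>, which is
        \<open>c$j * ?M j * \<bar>y$j\<bar>\<close>. Half of the Gaussian exponent absorbs this at
        the cost of the constant \<open>?K\<close>.\<close>
      let ?M = "\<lambda>j. R * \<bar>v$j\<bar> / c$j"
      let ?K = "exp (\<Sum>j\<in>UNIV. c$j * (R * \<bar>v$j\<bar> / c$j)\<^sup>2)"
      define g where "g y = C * (?K * gauss ((1/2) *\<^sub>R c) y)" for y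
      have "integrable lborel g"
        unfolding g_def[abs_def] using c by (intro integrable_mult_right integrable_gauss) auto
      moreover have "norm (P y * exp (- (\<i> * of_real (\<eta> \<bullet> y) + \<i> * z * of_real (v \<bullet> y)))) \<le> g y"
        if z: "norm z \<le> R" for y z
      proof -
        have R: "0 \<le> R" using z norm_ge_zero order_trans by blast
        have "c$j * (y$j)\<^sup>2 / 2 + Im z * (v$j * y$j) \<le> c$j * (y$j)\<^sup>2 + c$j * (?M j)\<^sup>2" for j
        proof -
          have "Im z * (v$j * y$j) \<le> \<bar>Im z\<bar> * (\<bar>v$j\<bar> * \<bar>y$j\<bar>)"
            by (metis abs_ge_self abs_mult)
          also have "\<dots> \<le> R * (\<bar>v$j\<bar> * \<bar>y$j\<bar>)"
            using z abs_Im_le_cmod[of z] by (intro mult_right_mono) auto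
          also have "\<dots> = c$j * (?M j * \<bar>y$j\<bar>)"
            using c[of j] by simp
          also have "\<dots> \<le> c$j * ((?M j)\<^sup>2 + (y$j)\<^sup>2 / 2)"
          proof (rule mult_left_mono)
            have "2 * (?M j * \<bar>y$j\<bar>) \<le> (?M j)\<^sup>2 + (y$j)\<^sup>2"
              using sum_squares_bound[of "?M j" "\<bar>y$j\<bar>"] by (simp only: mult.assoc power2_abs)
            then show "?M j * \<bar>y$j\<bar> \<le> (?M j)\<^sup>2 + (y$j)\<^sup>2 / 2"
              using zero_le_power2[of "?M j"] by linarith
          qed (use c[of j] in simp)
          finally show ?thesis by (simp add: distrib_left)
        qed
        then have "(\<Sum>j\<in>UNIV. c$j * (y$j)\<^sup>2 / 2 + Im z * (v$j * y$j)) \<le> (\<Sum>j\<in>UNIV. c$j * (y$j)\<^sup>2 + c$j * (?M j)\<^sup>2)"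
          by (rule sum_mono)
        then have "gauss c y * exp (Im z * (v \<bullet> y)) \<le> ?K * gauss ((1/2) *\<^sub>R c) y"
          by (simp add: gauss_def inner_vec_def sum.distrib sum_distrib_left sum_divide_distrib flip: exp_add)
        then have "C * (gauss c y * exp (Im z * (v \<bullet> y))) \<le> g y"
          unfolding g_def using C by (rule mult_left_mono)
        moreover have "norm (P y * exp (- (\<i> * of_real (\<eta> \<bullet> y) + \<i> * z * of_real (v \<bullet> y)))) \<le> C * gauss c y * exp (Im z * (v \<bullet> y))"
          using bound[of y] by (simp add: norm_mult mult_right_mono)
        ultimately show ?thesis by (simp add: mult.assoc)
      qed
      ultimately show "\<exists>g. integrable lborel g \<and> (\<forall>y z. norm z \<le> R \<longrightarrow>
          norm (P y * exp (- (\<i> * of_real (\<eta> \<bullet> y) + \<i> * z * of_real (v \<bullet> y)))) \<le> g y)"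
        by blast
    qed (auto intro!: holomorphic_intros)
    moreover have L_real: "L (of_real r) = (\<integral>y. P y * iexp (- ((\<eta> + r *\<^sub>R v) \<bullet> y)) \<partial>lborel)" for r
      unfolding L_def by (simp add: inner_add_left algebra_simps)
    \<comment> \<open>By continuity the transform of \<open>F\<close> stays nonzero on an interval
      around \<open>\<eta>\<close> in direction \<open>v\<close>, which forces \<open>L\<close> to
      vanish there.\<close>
    have "continuous_on UNIV (\<lambda>r. \<integral>t. F t * iexp ((\<eta> + r *\<^sub>R v) \<bullet> t) \<partial>lborel)"
      by (rule continuous_integral_parameter[OF F, where B=1]) (auto intro!: continuous_intros)
    then have "isCont (\<lambda>r. \<integral>t. F t * iexp ((\<eta> + r *\<^sub>R v) \<bullet> t) \<partial>lborel) 0"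
      by (simp add: continuous_on_eq_continuous_at)
    then obtain \<delta> where \<delta>: "\<delta> > 0" "\<And>r. dist 0 r < \<delta> \<Longrightarrow> (\<integral>t. F t * iexp ((\<eta> + r *\<^sub>R v) \<bullet> t) \<partial>lborel) \<noteq> 0"
      using continuous_at_avoid[of 0 "\<lambda>r. \<integral>t. F t * iexp ((\<eta> + r *\<^sub>R v) \<bullet> t) \<partial>lborel" 0] ne by auto
    have "L (of_real r) = 0" if "\<bar>r\<bar> < \<delta>" for r
      using prod[of "\<eta> + r *\<^sub>R v"] \<delta>(2)[of r] that unfolding L_real by (auto simp: dist_norm)
    ultimately have "L (of_real 1) = 0"
      using \<delta>(1) entire_eq_0_of_real_interval by blast
    then show ?thesis unfolding L_real by simp
  qed
  have "(\<integral>y. P y * iexp (\<omega> \<bullet> y) \<partial>lborel) = 0" for \<omega>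
    using W[of "- \<omega> - \<eta>"] by simp
  then show False
    using fourier_uniqueness[OF Pint] nz by blast
qed

section \<open>Entire extensions of the short-time Fourier transform\<close>

definition vec_upd :: "'a^'n \<Rightarrow> 'n \<Rightarrow> 'a \<Rightarrow> 'a^'n" where
  "vec_upd x j r = (\<chi> k. if k = j then r else x$k)"

lemma vec_upd_nth [simp]: "vec_upd x j r $ k = (if k = j then r else x$k)"
  by (simp add: vec_upd_def)

lemma vec_upd_same [simp]: "vec_upd x j (x$j) = x"
  by (simp add: vec_eq_iff)

text \<open>Induction on the set of coordinates already released from their sample sets.
  \<open>step\<close> must allow arbitrary values in the other coordinates, because some of them
  have been released before.\<close>

lemma coordinatewise_extension:
  fixes T :: "'n::finite \<Rightarrow> 'a set" and Q :: "'a^'n \<Rightarrow> bool"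
  assumes step: "\<And>x j r. (\<And>s. s \<in> T j \<Longrightarrow> Q (vec_upd x j s)) \<Longrightarrow> Q (vec_upd x j r)"
    and prod: "\<And>x. (\<And>j. x$j \<in> T j) \<Longrightarrow> Q x"
  shows "Q x"
proof -
  have "\<forall>x. (\<forall>j. j \<notin> S \<longrightarrow> x$j \<in> T j) \<longrightarrow> Q x" for S :: "'n set"
    using finite[of S]
  proof (induction S rule: finite_induct)
    case empty
    then show ?case using prod by blast
  next
    case (insert j S)
    show ?case
    proof (intro allI impI)
      fix x assume x: "\<forall>k. k \<notin> insert j S \<longrightarrow> x$k \<in> T k"
      have "Q (vec_upd x j s)" if "s \<in> T j" for s
        using insert.IH x that by (metis (no_types, lifting) insert_iff vec_upd_nth)
      from step[OF this] have "Q (vec_upd x j (x$j))" .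
      then show "Q x" by simp
    qed
  qed
  from this[of UNIV] show ?thesis by simp
qed

text \<open>An imaginary displacement of coordinate \<open>j\<close> in the window costs the factor
  \<open>exp (b$j * (Im z)\<^sup>2)\<close>, while the real part only moves the centre of the
  Gaussian. The centre does not affect the bound against \<open>f\<close>.\<close>

lemma STFT_time_extension:
  fixes a b x \<omega> :: "real^'n" and \<phi> :: "complex^'n \<Rightarrow> complex"
  assumes a: "\<And>j. 0 < a$j" and b: "\<And>j. 0 < b$j" and \<phi>: "\<phi> \<in> O_ab a b" and f: "f \<in> L2"
  obtains V K where "V holomorphic_on UNIV" "\<And>z. norm (V z) \<le> K * exp (b$j * (Im z)\<^sup>2)"
    "\<And>r. V (of_real r) = STFT (\<lambda>t. \<phi> (cvec t 0)) f (vec_upd x j r, \<omega>)"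
proof -
  have ent: "entire_cd \<phi>" using \<phi> by (simp add: O_ab_def)
  have [measurable]: "f \<in> borel_measurable borel" using f by (simp add: L2_def)
  obtain C where C: "C > 0" "\<And>x y. norm (\<phi> (cvec x y)) \<le> C * gauss a x * exp (\<Sum>j\<in>UNIV. b$j * (y$j)\<^sup>2)"
    using O_ab_bound[OF \<phi>] by blast
  \<comment> \<open>The window enters conjugated, so \<open>cnj z\<close> is inserted to make the
    whole expression holomorphic in \<open>z\<close>. The direction is negative because the window
    is evaluated at \<open>t - x\<close>.\<close>
  define \<Phi> where "\<Phi> t z = cnj (\<phi> (cvec (t - vec_upd x j 0) 0 + (\<chi> k. cnj z * (- axis j 1) $ k)))" for t z
  define e where "e t = exp (- 2 * complex_of_real pi * \<i> * complex_of_real (\<omega> \<bullet> t))" for t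
  have ne: "norm (e t) = 1" for t by (simp add: e_def)
  have \<Phi>: "\<Phi> t z = cnj (\<phi> (cvec (t - vec_upd x j (Re z)) (axis j (Im z))))" for t z
  proof -
    have "cvec (t - vec_upd x j 0) 0 + (\<chi> k. cnj z * (- axis j 1) $ k) = cvec (t - vec_upd x j (Re z)) (axis j (Im z))"
      by (auto simp: vec_eq_iff cvec_def complex_eq_iff axis_def)
    then show ?thesis by (simp add: \<Phi>_def)
  qed
  have \<Phi>_le: "norm (\<Phi> t z) \<le> C * exp (b$j * (Im z)\<^sup>2) * gauss a (t - vec_upd x j (Re z))" for t z
  proof -
    have "b$k * (axis j (Im z) $ k)\<^sup>2 = (if k = j then b$j * (Im z)\<^sup>2 else 0)" for k
      by (simp add: axis_def)
    then show ?thesis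
      using C(2)[of "t - vec_upd x j (Re z)" "axis j (Im z)"] by (simp add: \<Phi> mult_ac)
  qed
  have le: "norm (f t * \<Phi> t z * e t) \<le> C * exp (b$j * (Im z)\<^sup>2) * (norm (f t) * gauss a (t - vec_upd x j (Re z)))" for t z
    using mult_left_mono[OF \<Phi>_le[of t z] norm_ge_zero[of "f t"]] by (simp add: norm_mult ne mult_ac)
  have meas\<Phi>: "(\<lambda>t. \<Phi> t z) \<in> borel_measurable borel" for z
    unfolding \<Phi>
    by (intro borel_measurable_continuous_onI continuous_on_cnj continuous_on_compose2[OF entire_cd_continuous[OF ent, of UNIV] continuous_cvec]) auto
  have meas: "(\<lambda>t. f t * \<Phi> t z * e t) \<in> borel_measurable lborel" for z
    using meas\<Phi>[of z] unfolding e_def[abs_def] by simp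
  define V where "V z = (\<integral>t. f t * \<Phi> t z * e t \<partial>lborel)" for z
  let ?K = "C * (((\<integral>t. (norm (f t))\<^sup>2 \<partial>lborel) + (\<integral>t. gauss (2 *\<^sub>R a) t \<partial>lborel)) / 2)"
  show thesis
  proof (rule that[of V ?K])
    show "V holomorphic_on UNIV"
      unfolding V_def[abs_def]
    proof (rule holomorphic_integral_parameter[OF _ meas])
      fix t
      have "(cnj \<circ> (\<lambda>z. \<phi> (cvec (t - vec_upd x j 0) 0 + (\<chi> k. z * (- axis j 1) $ k))) \<circ> cnj) holomorphic_on UNIV"
        by (intro holomorphic_on_compose_cnj_cnj holomorphic_on_subset[OF entire_cd_line[OF ent]] subset_UNIV open_UNIV)
      then have "\<Phi> t holomorphic_on UNIV"
        unfolding \<Phi>_def[abs_def] o_def .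
      then show "(\<lambda>z. f t * \<Phi> t z * e t) holomorphic_on UNIV"
        by (intro holomorphic_intros)
    next
      fix R :: real
      \<comment> \<open>This majorant is free of \<open>z\<close>: the growth factor is taken at
        \<open>R\<close>, and the moving Gaussian is replaced by a wider one at the origin.\<close>
      let ?g = "\<lambda>t. C * exp (b$j * R\<^sup>2) * exp (\<Sum>k\<in>UNIV. a$k * (\<bar>x$k\<bar> + R)\<^sup>2) * (norm (f t) * gauss ((1/2) *\<^sub>R a) (t - 0))"
      have "integrable lborel ?g"
        using a by (intro integrable_mult_right integrable_L2_gauss[OF f]) auto
      moreover have "norm (f t * \<Phi> t z * e t) \<le> ?g t" if z: "norm z \<le> R" for t z
      proof -
        have R: "0 \<le> R" using z norm_ge_zero order_trans by blast
        have "\<bar>Im z\<bar> \<le> R" "\<bar>Re z\<bar> \<le> R"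
          using abs_Im_le_cmod[of z] abs_Re_le_cmod[of z] z by linarith+
        have "(Im z)\<^sup>2 \<le> R\<^sup>2"
          using \<open>\<bar>Im z\<bar> \<le> R\<close> R abs_le_square_iff[of "Im z" R] by simp
        then have 1: "exp (b$j * (Im z)\<^sup>2) \<le> exp (b$j * R\<^sup>2)"
          using b[of j] by simp
        have 2: "gauss a (t - vec_upd x j (Re z)) \<le> exp (\<Sum>k\<in>UNIV. a$k * (\<bar>x$k\<bar> + R)\<^sup>2) * gauss ((1/2) *\<^sub>R a) t"
          using a R \<open>\<bar>Re z\<bar> \<le> R\<close> by (intro gauss_diff_le) (auto intro: less_imp_le)
        have "norm (f t * \<Phi> t z * e t) \<le> C * exp (b$j * (Im z)\<^sup>2) * (norm (f t) * gauss a (t - vec_upd x j (Re z)))"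
          by (rule le)
        also have "\<dots> \<le> C * exp (b$j * R\<^sup>2) * (norm (f t) * (exp (\<Sum>k\<in>UNIV. a$k * (\<bar>x$k\<bar> + R)\<^sup>2) * gauss ((1/2) *\<^sub>R a) t))"
          using C(1) by (intro mult_mono 1 2 order_refl) auto
        finally show ?thesis by (simp add: mult_ac)
      qed
      ultimately show "\<exists>g. integrable lborel g \<and> (\<forall>t z. norm z \<le> R \<longrightarrow> norm (f t * \<Phi> t z * e t) \<le> g t)"
        by blast
    qed
    show "norm (V z) \<le> ?K * exp (b$j * (Im z)\<^sup>2)" for z
    proof -
      have I: "integrable lborel (\<lambda>t. C * exp (b$j * (Im z)\<^sup>2) * (norm (f t) * gauss a (t - vec_upd x j (Re z))))"
        using a by (intro integrable_mult_right integrable_L2_gauss[OF f]) auto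
      have "norm (V z) \<le> (\<integral>t. norm (f t * \<Phi> t z * e t) \<partial>lborel)"
        unfolding V_def by (rule integral_norm_bound)
      also have "\<dots> \<le> (\<integral>t. C * exp (b$j * (Im z)\<^sup>2) * (norm (f t) * gauss a (t - vec_upd x j (Re z))) \<partial>lborel)"
        by (rule integral_mono'[OF I le]) (use C in auto)
      also have "\<dots> = C * exp (b$j * (Im z)\<^sup>2) * (\<integral>t. norm (f t) * gauss a (t - vec_upd x j (Re z)) \<partial>lborel)"
        by simp
      also have "\<dots> \<le> C * exp (b$j * (Im z)\<^sup>2) * (((\<integral>t. (norm (f t))\<^sup>2 \<partial>lborel) + (\<integral>t. gauss (2 *\<^sub>R a) t \<partial>lborel)) / 2)"
        using C a by (intro mult_left_mono integral_L2_gauss_le[OF f]) auto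
      finally show ?thesis by (simp add: mult_ac)
    qed
    have ax: "axis j (0::real) = 0" by (simp add: vec_eq_iff axis_def)
    show "V (of_real r) = STFT (\<lambda>t. \<phi> (cvec t 0)) f (vec_upd x j r, \<omega>)" for r
      by (simp add: V_def STFT_def \<Phi> e_def ax)
  qed
qed

text \<open>Only the character depends on \<open>z\<close>, and its modulus is
  \<open>exp (2 * pi * Im z * t$j)\<close>. The decay of the window absorbs it by completing the
  square. Since the window is centred at \<open>x\<close>, a term linear in \<open>Im z\<close>
  remains.\<close>

lemma STFT_frequency_extension:
  fixes a b x \<omega> :: "real^'n" and \<phi> :: "complex^'n \<Rightarrow> complex"
  assumes a: "\<And>j. 0 < a$j" and \<phi>: "\<phi> \<in> O_ab a b" and f: "f \<in> L2"
  obtains V K where "V holomorphic_on UNIV"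
    "\<And>z. norm (V z) \<le> K * exp (pi\<^sup>2 / a$j * (Im z)\<^sup>2 + 2 * pi * x$j * Im z)"
    "\<And>r. V (of_real r) = STFT (\<lambda>t. \<phi> (cvec t 0)) f (x, vec_upd \<omega> j r)"
proof -
  have ent: "entire_cd \<phi>" using \<phi> by (simp add: O_ab_def)
  have [measurable]: "f \<in> borel_measurable borel" using f by (simp add: L2_def)
  obtain C where C: "C > 0" "\<And>x y. norm (\<phi> (cvec x y)) \<le> C * gauss a x * exp (\<Sum>j\<in>UNIV. b$j * (y$j)\<^sup>2)"
    using O_ab_bound[OF \<phi>] by blast
  define e where "e t z = exp (- 2 * complex_of_real pi * \<i> * (complex_of_real (vec_upd \<omega> j 0 \<bullet> t) + z * of_real (t$j)))" for t z
  have ne: "norm (e t z) = exp (2 * pi * Im z * t$j)" for t z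
    by (simp add: e_def)
  define \<Phi> where "\<Phi> t = cnj (\<phi> (cvec (t - x) 0))" for t
  have meas\<Phi>[measurable]: "\<Phi> \<in> borel_measurable borel"
    unfolding \<Phi>_def[abs_def]
    by (intro borel_measurable_continuous_onI continuous_on_cnj continuous_on_compose2[OF entire_cd_continuous[OF ent, of UNIV] continuous_cvec]) auto
  have [measurable]: "(\<lambda>t. e t z) \<in> borel_measurable borel" for z
    unfolding e_def by measurable
  define E where "E z = exp (pi\<^sup>2 / a$j * (Im z)\<^sup>2 + 2 * pi * x$j * Im z)" for z
  \<comment> \<open>The centre of the Gaussian after the square in \<open>t - x\<close> has been
    completed.\<close>
  define y where "y z = x + axis j (pi * Im z / a$j)" for z
  have le: "norm (f t * \<Phi> t * e t z) \<le> C * E z * (norm (f t) * gauss a (t - y z))" for t z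
  proof -
    have "norm (\<Phi> t) * norm (e t z) \<le> C * gauss a (t - x) * exp (2 * pi * Im z * t$j)"
      using C(2)[of "t - x" 0] unfolding ne by (intro mult_right_mono) (auto simp: \<Phi>_def)
    also have "\<dots> = C * exp (2 * pi * x$j * Im z) * (gauss a (t - x) * exp (2 * pi * Im z * (t - x)$j))"
      by (simp add: algebra_simps flip: exp_add)
    also have "\<dots> = C * E z * gauss a (t - y z)"
      using a[of j] by (subst gauss_complete_square) (auto simp: E_def y_def exp_add algebra_simps)
    finally have "norm (f t) * (norm (\<Phi> t) * norm (e t z)) \<le> norm (f t) * (C * E z * gauss a (t - y z))"
      by (rule mult_left_mono) simp
    then show ?thesis by (simp add: norm_mult mult_ac)
  qed
  define V where "V z = (\<integral>t. f t * \<Phi> t * e t z \<partial>lborel)" for z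
  let ?K = "C * (((\<integral>t. (norm (f t))\<^sup>2 \<partial>lborel) + (\<integral>t. gauss (2 *\<^sub>R a) t \<partial>lborel)) / 2)"
  show thesis
  proof (rule that[of V ?K])
    show "V holomorphic_on UNIV"
      unfolding V_def[abs_def]
    proof (rule holomorphic_integral_parameter)
      show "(\<lambda>z. f t * \<Phi> t * e t z) holomorphic_on UNIV" for t
        unfolding e_def by (intro holomorphic_intros)
      show "(\<lambda>t. f t * \<Phi> t * e t z) \<in> borel_measurable lborel" for z
        by measurable
    next
      fix R :: real
      let ?E = "exp (pi\<^sup>2 / a$j * R\<^sup>2 + 2 * pi * \<bar>x$j\<bar> * R)"
      let ?S = "exp (\<Sum>k\<in>UNIV. a$k * (\<bar>x$k\<bar> + pi * R / a$j)\<^sup>2)"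
      let ?g = "\<lambda>t. C * ?E * ?S * (norm (f t) * gauss ((1/2) *\<^sub>R a) (t - 0))"
      have "integrable lborel ?g"
        using a by (intro integrable_mult_right integrable_L2_gauss[OF f]) auto
      moreover have "norm (f t * \<Phi> t * e t z) \<le> ?g t" if z: "norm z \<le> R" for t z
      proof -
        have R: "0 \<le> R" using z norm_ge_zero order_trans by blast
        have im: "\<bar>Im z\<bar> \<le> R"
          using abs_Im_le_cmod[of z] z by linarith
        have "(Im z)\<^sup>2 \<le> R\<^sup>2"
          using im R abs_le_square_iff[of "Im z" R] by simp
        then have "pi\<^sup>2 / a$j * (Im z)\<^sup>2 \<le> pi\<^sup>2 / a$j * R\<^sup>2"
          using a[of j] by (intro mult_left_mono) auto
        moreover have "x$j * Im z \<le> \<bar>x$j\<bar> * R"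
        proof -
          have "x$j * Im z \<le> \<bar>x$j\<bar> * \<bar>Im z\<bar>" by (metis abs_ge_self abs_mult)
          also have "\<dots> \<le> \<bar>x$j\<bar> * R" using im by (intro mult_left_mono) auto
          finally show ?thesis .
        qed
        then have "2 * pi * (x$j * Im z) \<le> 2 * pi * (\<bar>x$j\<bar> * R)"
          by (intro mult_left_mono) auto
        ultimately have 1: "E z \<le> ?E"
          unfolding E_def exp_le_cancel_iff by (simp only: mult.assoc add_mono)
        have 2: "gauss a (t - y z) \<le> ?S * gauss ((1/2) *\<^sub>R a) t"
        proof (rule gauss_diff_le)
          fix k
          show "0 \<le> a$k" using a[of k] by simp
          have "\<bar>pi * Im z / a$j\<bar> \<le> pi * R / a$j"
            using im a[of j] by (simp add: abs_mult divide_right_mono)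
          then show "\<bar>y z $ k\<bar> \<le> \<bar>x$k\<bar> + pi * R / a$j"
            using a[of j] R by (auto simp: y_def axis_def intro!: order_trans[OF abs_triangle_ineq])
        qed
        have "norm (f t * \<Phi> t * e t z) \<le> C * E z * (norm (f t) * gauss a (t - y z))"
          by (rule le)
        also have "\<dots> \<le> C * ?E * (norm (f t) * (?S * gauss ((1/2) *\<^sub>R a) t))"
          using C(1) by (intro mult_mono 1 2 order_refl) (auto simp: E_def)
        finally show ?thesis by (simp add: mult_ac)
      qed
      ultimately show "\<exists>g. integrable lborel g \<and> (\<forall>t z. norm z \<le> R \<longrightarrow> norm (f t * \<Phi> t * e t z) \<le> g t)"
        by blast
    qed
    show "norm (V z) \<le> ?K * exp (pi\<^sup>2 / a$j * (Im z)\<^sup>2 + 2 * pi * x$j * Im z)" for z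
      unfolding E_def[symmetric]
    proof -
      have E0: "0 \<le> E z" by (simp add: E_def)
      have I: "integrable lborel (\<lambda>t. C * E z * (norm (f t) * gauss a (t - y z)))"
        using a by (intro integrable_mult_right integrable_L2_gauss[OF f]) auto
      have "norm (V z) \<le> (\<integral>t. norm (f t * \<Phi> t * e t z) \<partial>lborel)"
        unfolding V_def by (rule integral_norm_bound)
      also have "\<dots> \<le> (\<integral>t. C * E z * (norm (f t) * gauss a (t - y z)) \<partial>lborel)"
        by (rule integral_mono'[OF I le]) (use C E0 in auto)
      also have "\<dots> = C * E z * (\<integral>t. norm (f t) * gauss a (t - y z) \<partial>lborel)"
        by simp
      also have "\<dots> \<le> C * E z * (((\<integral>t. (norm (f t))\<^sup>2 \<partial>lborel) + (\<integral>t. gauss (2 *\<^sub>R a) t \<partial>lborel)) / 2)"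
        using C a E0 by (intro mult_left_mono integral_L2_gauss_le[OF f]) auto
      finally show "norm (V z) \<le> ?K * E z" by (simp add: mult_ac)
    qed
    show "V (of_real r) = STFT (\<lambda>t. \<phi> (cvec t 0)) f (x, vec_upd \<omega> j r)" for r
    proof -
      have "vec_upd \<omega> j r = vec_upd \<omega> j 0 + axis j r"
        by (simp add: vec_eq_iff axis_def)
      then have "vec_upd \<omega> j r \<bullet> t = vec_upd \<omega> j 0 \<bullet> t + r * t$j" for t
        by (simp add: inner_add_left inner_axis')
      then show ?thesis
        by (simp add: V_def STFT_def \<Phi>_def e_def)
    qed
  qed
qed

section \<open>Phase retrieval\<close>

lemma borel_measurable_cnj [measurable]:
  "f \<in> borel_measurable M \<Longrightarrow> (\<lambda>x. cnj (f x)) \<in> borel_measurable M"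
  by (rule measurable_compose[OF _ borel_measurable_continuous_onI[OF continuous_on_cnj[OF continuous_on_id]]])

lemma not_AE_obtain:
  assumes "\<not> (AE t in M. P t)" and "AE t in M. Q t"
  obtains t where "\<not> P t" "Q t"
  using assms by (metis (mono_tags, lifting) eventually_mono)

text \<open>By Fubini and a change of variable, \<open>f t * cnj (f s) = h t * cnj (h s)\<close> for
  almost all \<open>t\<close> and almost all \<open>s\<close>. Fixing one good \<open>t\<close>
  makes \<open>f\<close> a multiple of \<open>h\<close>; inserting this back shows that the factor
  is unimodular.\<close>

lemma phase_from_correlations:
  fixes f h :: "'a::euclidean_space \<Rightarrow> complex"
  assumes [measurable]: "f \<in> borel_measurable borel" "h \<in> borel_measurable borel"
    and eq: "AE s in lborel. AE t in lborel. f t * cnj (f (t - s)) = h t * cnj (h (t - s))"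
  shows "\<exists>c. norm c = 1 \<and> (AE t in lborel. f t = c * h t)"
proof -
  have "AE t in lborel. AE s in lborel. f t * cnj (f (t - s)) = h t * cnj (h (t - s))"
    using eq by (subst lborel_pair.AE_commute) measurable
  moreover have "AE s in lborel. f t * cnj (f s) = h t * cnj (h s)"
    if "AE s in lborel. f t * cnj (f (t - s)) = h t * cnj (h (t - s))" for t
    using that by (subst lborel_distr_minus_left[of t, symmetric]) (subst AE_distr_iff, auto)
  ultimately have ae: "AE t in lborel. AE s in lborel. f t * cnj (f s) = h t * cnj (h s)"
    by (auto elim: eventually_mono)
  show ?thesis
  \<comment> \<open>If \<open>h\<close> is a null function, so is \<open>f\<close>, and the factor 1
    serves; otherwise there is a good \<open>t\<close> with \<open>h t \<noteq> 0\<close>.\<close>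
  proof (cases "AE t in lborel. h t = 0")
    case True
    have "AE t in lborel. f t = 0"
    proof (rule ccontr)
      assume nz: "\<not> (AE t in lborel. f t = 0)"
      then obtain t where t: "f t \<noteq> 0" "AE s in lborel. f t * cnj (f s) = h t * cnj (h s)"
        using ae by (rule not_AE_obtain)
      from t(2) True have "AE s in lborel. f s = 0"
        by eventually_elim (use t(1) in auto)
      with nz show False by simp
    qed
    with True show ?thesis
      by (intro exI[of _ 1]) (auto elim: eventually_elim2)
  next
    case False
    then obtain t where t: "h t \<noteq> 0" "AE s in lborel. f t * cnj (f s) = h t * cnj (h s)"
      using ae by (rule not_AE_obtain)
    have ft: "f t \<noteq> 0"
    proof
      assume "f t = 0"
      then have "AE s in lborel. h s = 0"
        using t by (auto elim: eventually_mono)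
      with False show False by simp
    qed
    define c where "c = cnj (h t / f t)"
    have c: "AE s in lborel. f s = c * h s"
      using t(2)
    proof eventually_elim
      case (elim s)
      then have "cnj (f s) = h t / f t * cnj (h s)" using ft by (simp add: field_simps)
      then show ?case unfolding c_def by (metis complex_cnj_cnj complex_cnj_mult)
    qed
    have "AE t in lborel. AE s in lborel. c * cnj c * (h t * cnj (h s)) = h t * cnj (h s)"
      using ae c
    proof eventually_elim
      case (elim t)
      from elim(1) c show ?case
        by eventually_elim (use elim(2) in \<open>auto simp: mult_ac\<close>)
    qed
    with False obtain t where t: "h t \<noteq> 0" "AE s in lborel. c * cnj c * (h t * cnj (h s)) = h t * cnj (h s)"
      by (rule not_AE_obtain)
    from False t(2) obtain s where s: "h s \<noteq> 0" "c * cnj c * (h t * cnj (h s)) = h t * cnj (h s)"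
      by (rule not_AE_obtain)
    have nz: "h t * cnj (h s) \<noteq> 0"
      using s(1) t(1) by simp
    have "c * cnj c = 1"
      by (rule mult_right_cancel[OF nz, THEN iffD1]) (unfold mult_1_left, rule s(2))
    then have "complex_of_real ((norm c)\<^sup>2) = of_real 1" unfolding complex_norm_square of_real_1 .
    then have "(norm c)\<^sup>2 = 1" unfolding of_real_eq_iff .
    then have "norm c = 1" by (simp add: power2_eq_1_iff) (use norm_ge_zero[of c] in linarith)
    with c show ?thesis by blast
  qed
qed

text \<open>For fixed \<open>x\<close> the squared modulus is the Fourier transform of an
  autocorrelation. Regrouping its integrand separates the signals from the window and leaves a
  deconvolution problem for each shift \<open>s\<close>.\<close>

lemma phase_retrieval_full_STFT:
  fixes a b :: "real^'n" and \<phi> :: "complex^'n \<Rightarrow> complex"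
  assumes a: "\<And>j. 0 < a$j" and \<phi>: "\<phi> \<in> O_ab a b" "\<phi> \<noteq> (\<lambda>_. 0)" and f: "f \<in> L2" and h: "h \<in> L2"
    and eq: "\<And>x \<omega>. norm (STFT (\<lambda>t. \<phi> (cvec t 0)) f (x, \<omega>)) = norm (STFT (\<lambda>t. \<phi> (cvec t 0)) h (x, \<omega>))"
  shows "\<exists>c. norm c = 1 \<and> (AE t in lborel. f t = c * h t)"
proof -
  define g where "g t = \<phi> (cvec t 0)" for t
  have ent: "entire_cd \<phi>" using \<phi> by (simp add: O_ab_def)
  have contg: "continuous_on S g" for S
    unfolding g_def[abs_def] using continuous_cvec[of S 0 0]
    by (intro continuous_on_compose2[OF entire_cd_continuous[OF ent, of UNIV]]) auto
  have [measurable]: "g \<in> borel_measurable borel"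
    using contg by (rule borel_measurable_continuous_onI)
  obtain C where C: "C > 0" "\<And>x y. norm (\<phi> (cvec x y)) \<le> C * gauss a x * exp (\<Sum>j\<in>UNIV. b$j * (y$j)\<^sup>2)"
    using O_ab_bound[OF \<phi>(1)] by blast
  have g_le: "norm (g t) \<le> C * gauss a t" for t
    using C(2)[of t 0] by (simp add: g_def)
  have g_le_C: "norm (g t) \<le> C" for t
    using order_trans[OF g_le mult_left_mono[OF gauss_le_1, of a C t]] C(1) a by (simp add: less_imp_le)
  have meas: "f \<in> borel_measurable borel" "h \<in> borel_measurable borel"
    using f h by (auto simp: L2_def)
  note [measurable] = meas
  define P where "P s y = cnj (g y) * g (y - s)" for s y
  define F where "F s t = f t * cnj (f (t - s)) - h t * cnj (h (t - s))" for s t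
  have [measurable]: "P s \<in> borel_measurable borel" for s
    unfolding P_def[abs_def] by measurable
  \<comment> \<open>One window factor supplies the Gaussian and the other only a constant, so the
    bound is uniform in \<open>s\<close>.\<close>
  have P_le: "norm (P s y) \<le> C\<^sup>2 * gauss a y" for s y
    using mult_mono[OF g_le[of y] g_le_C[of "y - s"]] C(1)
    by (simp add: P_def norm_mult power2_eq_square mult_ac)
  have P_bdd: "norm (P s y) \<le> C\<^sup>2" for s y
    using order_trans[OF P_le mult_left_mono[OF gauss_le_1, of a "C\<^sup>2" y]] a by (simp add: less_imp_le)
  have ff: "integrable lborel (\<lambda>t. k t * cnj (k (t - s)))" if k: "k \<in> L2" for k :: "real^'n \<Rightarrow> complex" and s
  proof (rule integrable_mult_of_squares)
    have [measurable]: "k \<in> borel_measurable borel" using k by (simp add: L2_def)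
    show "integrable lborel (\<lambda>t. (norm (k t))\<^sup>2)" using k by (simp add: L2_def)
    then show "integrable lborel (\<lambda>t. (norm (cnj (k (t - s))))\<^sup>2)"
      using lborel_integrable_translate[of "\<lambda>t. (norm (k t))\<^sup>2" s] by simp
  qed (use k in \<open>auto simp: L2_def\<close>)
  have Fint: "integrable lborel (F s)" for s
    unfolding F_def[abs_def] using ff f h by (intro Bochner_Integration.integrable_diff)
  have kg: "integrable lborel (\<lambda>t. k t * cnj (g (t - x)))" if k: "k \<in> L2" for k :: "real^'n \<Rightarrow> complex" and x
  proof (rule Bochner_Integration.integrable_bound)
    show "integrable lborel (\<lambda>t. C * (norm (k t) * gauss a (t - x)))"
      using k a by (intro integrable_mult_right integrable_L2_gauss)
    show "(\<lambda>t. k t * cnj (g (t - x))) \<in> borel_measurable lborel"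
      using k by (auto simp: L2_def)
    have "norm (k t * cnj (g (t - x))) \<le> norm (C * (norm (k t) * gauss a (t - x)))" for t
      using mult_left_mono[OF g_le[of "t - x"] norm_ge_zero[of "k t"]] C(1)
      by (simp add: norm_mult abs_mult mult_ac)
    then show "AE t in lborel. norm (k t * cnj (g (t - x))) \<le> norm (C * (norm (k t) * gauss a (t - x)))"
      by simp
  qed
  have auto_corr: "(\<integral>s. (\<integral>t. (k t * cnj (g (t - x))) * cnj (k (t - s) * cnj (g (t - s - x))) \<partial>lborel) * iexp (\<omega> \<bullet> s) \<partial>lborel)
      = of_real ((norm (STFT g k (x, - (1 / (2 * pi)) *\<^sub>R \<omega>)))\<^sup>2)"
    and auto_int: "integrable lborel (\<lambda>s. \<integral>t. (k t * cnj (g (t - x))) * cnj (k (t - s) * cnj (g (t - s - x))) \<partial>lborel)"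
    if k: "k \<in> L2" for k :: "real^'n \<Rightarrow> complex" and x \<omega>
  proof -
    let ?u = "\<lambda>t. k t * cnj (g (t - x))"
    have u: "integrable lborel ?u" "integrable lborel (\<lambda>t. cnj (?u t))"
      using kg[OF k, of x] integrable_cnj by blast+
    show "integrable lborel (\<lambda>s. \<integral>t. ?u t * cnj (?u (t - s)) \<partial>lborel)"
      using lborel_pair.integrable_snd[OF integrable_pair_correlation[OF u]] by simp
    \<comment> \<open>The frequency is rescaled by \<open>- 1 / (2 * pi)\<close> because the
      transform uses \<open>exp (- 2 * pi * \<i> * ...)\<close> where characteristic functions use
      \<open>iexp\<close>.\<close>
    have st: "STFT g k (x, - (1 / (2 * pi)) *\<^sub>R \<omega>) = (\<integral>t. ?u t * iexp (\<omega> \<bullet> t) \<partial>lborel)"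
      by (simp add: STFT_def field_simps)
    have "(\<integral>s. (\<integral>t. ?u t * cnj (?u (t - s)) \<partial>lborel) * iexp (\<omega> \<bullet> s) \<partial>lborel)
        = (\<integral>t. ?u t * iexp (\<omega> \<bullet> t) \<partial>lborel) * (\<integral>t. cnj (?u t) * iexp (- (\<omega> \<bullet> t)) \<partial>lborel)"
      by (rule fourier_correlation[OF u])
    also have "(\<integral>t. cnj (?u t) * iexp (- (\<omega> \<bullet> t)) \<partial>lborel) = cnj (\<integral>t. ?u t * iexp (\<omega> \<bullet> t) \<partial>lborel)"
      by (subst Bochner_Integration.integral_cnj[symmetric]) (simp add: exp_cnj)
    finally show "(\<integral>s. (\<integral>t. ?u t * cnj (?u (t - s)) \<partial>lborel) * iexp (\<omega> \<bullet> s) \<partial>lborel)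
      = of_real ((norm (STFT g k (x, - (1 / (2 * pi)) *\<^sub>R \<omega>)))\<^sup>2)"
      unfolding st complex_norm_square .
  qed
  have conv_ae: "AE s in lborel. (\<integral>t. F s t * P s (t - x) \<partial>lborel) = 0" for x
  proof -
    let ?A = "\<lambda>k s. \<integral>t. (k t * cnj (g (t - x))) * cnj (k (t - s) * cnj (g (t - s - x))) \<partial>lborel"
    have "AE s in lborel. ?A f s - ?A h s = 0"
    proof (rule fourier_uniqueness)
      show "integrable lborel (\<lambda>s. ?A f s - ?A h s)"
        using auto_int f h by (intro Bochner_Integration.integrable_diff)
      have I: "integrable lborel (\<lambda>s. ?A k s * iexp (\<omega> \<bullet> s))" if "k \<in> L2" for k \<omega>
        using auto_int[OF that] by (intro integrable_times_iexp) auto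
      show "(\<integral>s. (?A f s - ?A h s) * iexp (\<omega> \<bullet> s) \<partial>lborel) = 0" for \<omega>
        unfolding left_diff_distrib
        by (subst Bochner_Integration.integral_diff[OF I[OF f] I[OF h]])
           (simp only: auto_corr[OF f] auto_corr[OF h] eq[folded g_def] diff_self)
    qed
    moreover have "?A f s - ?A h s = (\<integral>t. F s t * P s (t - x) \<partial>lborel)" for s
    proof -
      \<comment> \<open>Here the four factors are regrouped into signal times window:
        \<open>cnj (g (t - x)) * g (t - x - s)\<close> is \<open>P s (t - x)\<close>.\<close>
      have A: "?A k s = (\<integral>t. (k t * cnj (k (t - s))) * P s (t - x) \<partial>lborel)" for k
        by (intro Bochner_Integration.integral_cong refl) (simp add: P_def algebra_simps)
      have I: "integrable lborel (\<lambda>t. (k t * cnj (k (t - s))) * P s (t - x))" if k: "k \<in> L2" for k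
      proof (rule Bochner_Integration.integrable_bound)
        show "integrable lborel (\<lambda>t. C\<^sup>2 * norm (k t * cnj (k (t - s))))"
          using ff[OF k] by (intro integrable_mult_right integrable_norm)
        show "(\<lambda>t. (k t * cnj (k (t - s))) * P s (t - x)) \<in> borel_measurable lborel"
          using k by (auto simp: L2_def)
        show "AE t in lborel. norm ((k t * cnj (k (t - s))) * P s (t - x)) \<le> norm (C\<^sup>2 * norm (k t * cnj (k (t - s))))"
          using P_bdd by (intro AE_I2) (simp add: norm_mult mult.commute[of "C\<^sup>2"] mult_left_mono)
      qed
      show ?thesis
        unfolding A F_def left_diff_distrib
        by (rule Bochner_Integration.integral_diff[symmetric]) (rule I f h)+
    qed
    ultimately show ?thesis by (simp only:)
  qed
  \<comment> \<open>The exceptional null set of shifts depends on \<open>x\<close>. A countable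
    dense set of \<open>x\<close> needs only one null set, and continuity in \<open>x\<close> then
    covers the rest.\<close>
  obtain D :: "(real^'n) set" where D: "countable D" "\<And>X. open X \<Longrightarrow> X \<noteq> {} \<Longrightarrow> \<exists>d\<in>D. d \<in> X"
    using countable_dense_setE by blast
  have "AE s in lborel. \<forall>x\<in>D. (\<integral>t. F s t * P s (t - x) \<partial>lborel) = 0"
    using conv_ae D(1) by (simp add: AE_ball_countable)
  then have "AE s in lborel. AE t in lborel. F s t = 0"
  proof eventually_elim
    case (elim s)
    have "continuous_on UNIV (\<lambda>x. \<integral>t. F s t * P s (t - x) \<partial>lborel)"
    proof (rule continuous_integral_parameter[OF Fint, where B="C\<^sup>2"])
      show "norm (P s (t - x)) \<le> C\<^sup>2" for t x by (rule P_bdd)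
      show "continuous_on UNIV (\<lambda>x. P s (t - x))" for t
        unfolding P_def
        by (intro continuous_intros continuous_on_compose2[OF contg[of UNIV]]) auto
    qed measurable
    then have cl: "open {x. (\<integral>t. F s t * P s (t - x) \<partial>lborel) \<noteq> 0}"
      by (intro open_Collect_neq continuous_on_const)
    have zero: "(\<integral>t. F s t * P s (t - x) \<partial>lborel) = 0" for x
    proof (rule ccontr)
      assume "(\<integral>t. F s t * P s (t - x) \<partial>lborel) \<noteq> 0"
      then have "{x. (\<integral>t. F s t * P s (t - x) \<partial>lborel) \<noteq> 0} \<noteq> {}" by blast
      from D(2)[OF cl this] elim show False by blast
    qed
    have "\<not> (AE y in lborel. P s y = 0)"
    proof
      assume ae: "AE y in lborel. P s y = 0"
      have "continuous_on UNIV (P s)"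
        unfolding P_def[abs_def] by (intro continuous_intros contg continuous_on_compose2[OF contg[of UNIV]]) auto
      from continuous_AE_eq_0[OF this ae] have "P s y = 0" for y .
      moreover obtain y where "\<phi> (cvec y 0) \<noteq> 0" "\<phi> (cvec (y - s) 0) \<noteq> 0"
        using window_overlap[OF ent \<phi>(2)] by blast
      ultimately show False by (auto simp: P_def g_def)
    qed
    then show ?case
      by (intro gaussian_deconvolution[OF Fint _ P_le a zero]) measurable
  qed
  then have "AE s in lborel. AE t in lborel. f t * cnj (f (t - s)) = h t * cnj (h (t - s))"
    by (simp add: F_def)
  then show ?thesis
    by (rule phase_from_correlations[OF meas])
qed

text \<open>Elements of L2 are represented by functions, so \<open>f = c h\<close> is read almost
  everywhere. The window is the restriction of \<open>\<phi>\<close> to vectors with imaginary part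
  0.\<close>

theorem theorem1p1:
  fixes a b \<tau> \<nu> :: "real^'n" and \<phi> :: "complex^'n \<Rightarrow> complex"
    and f h :: "real^'n \<Rightarrow> complex"
  assumes "\<forall>j. a$j > 0" and "\<forall>j. b$j > 0"
    and "\<phi> \<in> O_ab a b" and "\<phi> \<noteq> (\<lambda>_. 0)"
    and "\<forall>j. \<tau>$j > 0" and "\<forall>j. \<nu>$j > 0"
    and "\<forall>j. \<tau>$j < sqrt (1 / (2 * b$j * exp 1))"
    and "\<forall>j. \<nu>$j < sqrt (a$j / (2 * pi^2 * exp 1))"
    and "f \<in> L2" and "h \<in> L2"
  shows "(\<forall>p\<in>diag_lattice \<tau> \<nu>.
            norm (STFT (\<lambda>t. \<phi> (cvec t 0)) f p) = norm (STFT (\<lambda>t. \<phi> (cvec t 0)) h p))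
         \<longleftrightarrow> (\<exists>c. norm c = 1 \<and> (AE t in lborel. f t = c * h t))"
proof
  let ?V = "STFT (\<lambda>t. \<phi> (cvec t 0))"
  assume "\<exists>c. norm c = 1 \<and> (AE t in lborel. f t = c * h t)"
  then obtain c where c: "norm c = 1" "AE t in lborel. f t = c * h t" by blast
  have [measurable]: "f \<in> borel_measurable borel" "h \<in> borel_measurable borel"
    using assms(9,10) by (auto simp: L2_def)
  have "entire_cd \<phi>" using assms(3) by (simp add: O_ab_def)
  then have [measurable]: "(\<lambda>t. \<phi> (cvec (t - x) 0)) \<in> borel_measurable borel" for x
    by (intro borel_measurable_continuous_onI continuous_on_compose2[OF entire_cd_continuous[of \<phi> UNIV] continuous_cvec]) auto
  have "?V f (x, \<omega>) = c * ?V h (x, \<omega>)" for x \<omega>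
  proof -
    have "?V f (x, \<omega>) = (\<integral>t. c * (h t * cnj (\<phi> (cvec (t - x) 0)) * exp (- 2 * complex_of_real pi * \<i> * complex_of_real (\<omega> \<bullet> t))) \<partial>lborel)"
      unfolding STFT_def prod.case
    proof (rule integral_cong_AE)
      show "AE t in lborel. f t * cnj (\<phi> (cvec (t - x) 0)) * exp (- 2 * complex_of_real pi * \<i> * complex_of_real (\<omega> \<bullet> t)) =
          c * (h t * cnj (\<phi> (cvec (t - x) 0)) * exp (- 2 * complex_of_real pi * \<i> * complex_of_real (\<omega> \<bullet> t)))"
        using c(2) by eventually_elim (simp add: mult_ac)
    qed measurable
    then show ?thesis by (simp add: STFT_def)
  qed
  then show "\<forall>p\<in>diag_lattice \<tau> \<nu>. norm (?V f p) = norm (?V h p)"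
    using c(1) by (auto simp: norm_mult)
next
  let ?V = "STFT (\<lambda>t. \<phi> (cvec t 0))"
  assume samples: "\<forall>p\<in>diag_lattice \<tau> \<nu>. norm (?V f p) = norm (?V h p)"
  have a: "\<And>j. 0 < a$j" and b: "\<And>j. 0 < b$j" and \<tau>: "\<And>j. 0 < \<tau>$j" and \<nu>: "\<And>j. 0 < \<nu>$j"
    using assms by auto
  \<comment> \<open>The bounds on \<open>\<tau>\<close> and \<open>\<nu>\<close> are the
    one-dimensional sampling condition, with \<open>B = b$j\<close> in time and
    \<open>B = pi\<^sup>2 / a$j\<close> in frequency.\<close>
  have \<tau>': "2 * b$j * (\<tau>$j)\<^sup>2 < 1 / exp 1" for j
  proof -
    have "(\<tau>$j)\<^sup>2 < (sqrt (1 / (2 * b$j * exp 1)))\<^sup>2"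
      using assms(7) \<tau>[of j] by (intro power_strict_mono) (auto simp: less_imp_le)
    also have "\<dots> = 1 / (2 * b$j * exp 1)"
      using b[of j] by simp
    finally show ?thesis using b[of j] by (simp add: field_simps)
  qed
  have \<nu>': "2 * (pi\<^sup>2 / a$j) * (\<nu>$j)\<^sup>2 < 1 / exp 1" for j
  proof -
    have "(\<nu>$j)\<^sup>2 < (sqrt (a$j / (2 * pi\<^sup>2 * exp 1)))\<^sup>2"
      using assms(8) \<nu>[of j] by (intro power_strict_mono) (auto simp: less_imp_le)
    also have "\<dots> = a$j / (2 * pi\<^sup>2 * exp 1)"
      using a[of j] by simp
    finally show ?thesis using a[of j] by (simp add: field_simps)
  qed
  have lattice: "norm (?V f (x, \<omega>)) = norm (?V h (x, \<omega>))"
    if x: "\<And>j. x$j \<in> (\<lambda>s. \<tau>$j * s) ` sqrtZ" and \<omega>: "\<And>j. \<omega>$j \<in> (\<lambda>s. \<nu>$j * s) ` sqrtZ" for x \<omega>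
  proof -
    obtain s where "\<And>j. s j \<in> sqrtZ \<and> x$j = \<tau>$j * s j"
      using x unfolding image_iff by metis
    moreover obtain r where "\<And>j. r j \<in> sqrtZ \<and> \<omega>$j = \<nu>$j * r j"
      using \<omega> unfolding image_iff by metis
    ultimately have "(x, \<omega>) \<in> diag_lattice \<tau> \<nu>"
      unfolding diag_lattice_def
      by (intro CollectI exI[of _ "\<chi> j. s j"] exI[of _ "\<chi> j. r j"]) (auto simp: vec_eq_iff)
    with samples show ?thesis by blast
  qed
  have sqrtZ: "\<tau> * sqrt (real n) \<in> (\<lambda>s. \<tau> * s) ` sqrtZ" "- \<tau> * sqrt (real n) \<in> (\<lambda>s. \<tau> * s) ` sqrtZ" for \<tau> n
    by (auto simp: sqrtZ_def image_iff)
  \<comment> \<open>The time coordinates are released first, with the frequency still on the grid;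
    afterwards the frequency coordinates are released at an arbitrary \<open>x\<close>.\<close>
  have time: "norm (?V f (x, \<omega>)) = norm (?V h (x, \<omega>))"
    if \<omega>: "\<And>j. \<omega>$j \<in> (\<lambda>s. \<nu>$j * s) ` sqrtZ" for x \<omega>
  proof (rule coordinatewise_extension[where T="\<lambda>j. (\<lambda>s. \<tau>$j * s) ` sqrtZ" and Q="\<lambda>x. norm (?V f (x, \<omega>)) = norm (?V h (x, \<omega>))"])
    fix x j r assume s: "\<And>s. s \<in> (\<lambda>s. \<tau>$j * s) ` sqrtZ \<Longrightarrow> norm (?V f (vec_upd x j s, \<omega>)) = norm (?V h (vec_upd x j s, \<omega>))"
    obtain V K where V: "V holomorphic_on UNIV" "\<And>z. norm (V z) \<le> K * exp (b$j * (Im z)\<^sup>2)" 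
        "\<And>r. V (of_real r) = ?V f (vec_upd x j r, \<omega>)"
      using STFT_time_extension[OF a b assms(3) assms(9)] by blast
    obtain W L where W: "W holomorphic_on UNIV" "\<And>z. norm (W z) \<le> L * exp (b$j * (Im z)\<^sup>2)" "\<And>r. W (of_real r) = ?V h (vec_upd x j r, \<omega>)"
      using STFT_time_extension[OF a b assms(3) assms(10)] by blast
    \<comment> \<open>In the time direction there is no linear term, so \<open>\<kappa>\<close> is
      0.\<close>
    have V2: "norm (V z) \<le> K * exp (b$j * (Im z)\<^sup>2 + 0 * Im z)" and W2: "norm (W z) \<le> L * exp (b$j * (Im z)\<^sup>2 + 0 * Im z)" for z
      using V(2) W(2) by simp_all
    have "norm (V (of_real r)) = norm (W (of_real r))"
      by (rule modulus_eq_of_sqrt_samples[OF V(1) W(1) V2 W2 less_imp_le[OF b] \<tau>[of j] \<tau>'[of j]];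
          unfold V(3) W(3); rule s, rule sqrtZ)
    then show "norm (?V f (vec_upd x j r, \<omega>)) = norm (?V h (vec_upd x j r, \<omega>))"
      unfolding V(3) W(3) .
  qed (use lattice \<omega> in blast)
  have "norm (?V f (x, \<omega>)) = norm (?V h (x, \<omega>))" for x \<omega>
  proof (rule coordinatewise_extension[where T="\<lambda>j. (\<lambda>s. \<nu>$j * s) ` sqrtZ" and Q="\<lambda>\<omega>. norm (?V f (x, \<omega>)) = norm (?V h (x, \<omega>))"])
    fix \<omega> j r assume s: "\<And>s. s \<in> (\<lambda>s. \<nu>$j * s) ` sqrtZ \<Longrightarrow> norm (?V f (x, vec_upd \<omega> j s)) = norm (?V h (x, vec_upd \<omega> j s))"
    obtain V K where V: "V holomorphic_on UNIV" "\<And>z. norm (V z) \<le> K * exp (pi\<^sup>2 / a$j * (Im z)\<^sup>2 + 2 * pi * x$j * Im z)" "\<And>r. V (of_real r) = ?V f (x, vec_upd \<omega> j r)"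
      using STFT_frequency_extension[OF a assms(3) assms(9)] by blast
    obtain W L where W: "W holomorphic_on UNIV" "\<And>z. norm (W z) \<le> L * exp (pi\<^sup>2 / a$j * (Im z)\<^sup>2 + 2 * pi * x$j * Im z)" "\<And>r. W (of_real r) = ?V h (x, vec_upd \<omega> j r)"
      using STFT_frequency_extension[OF a assms(3) assms(10)] by blast
    have "0 \<le> pi\<^sup>2 / a$j" using a[of j] by simp
    have "norm (V (of_real r)) = norm (W (of_real r))"
      by (rule modulus_eq_of_sqrt_samples[OF V(1) W(1) V(2) W(2) \<open>0 \<le> pi\<^sup>2 / a$j\<close> \<nu>[of j] \<nu>'[of j]];
          unfold V(3) W(3); rule s, rule sqrtZ)
    then show "norm (?V f (x, vec_upd \<omega> j r)) = norm (?V h (x, vec_upd \<omega> j r))"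
      unfolding V(3) W(3) .
  qed (use time in blast)
  then show "\<exists>c. norm c = 1 \<and> (AE t in lborel. f t = c * h t)"
    by (intro phase_retrieval_full_STFT[OF a assms(3,4,9,10)])
qed

end
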